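(* Let $X$ be a proper geodesic metric space and $\xi\in X$. Then the map $\omega_{(X,\xi)}\colon\sigma(X,\xi)\to\iota(X,\xi)$ is surjective.
   Context: Work in a nonstandard universe, with extension map $A\mapsto{}^{\ast}A$, satisfying the transfer principle and the saturation principle (every family of internal sets that has the finite intersection property and is indexed by a standard set has nonempty intersection). A metric space is proper if every closed bounded subset is compact. A metric space $(X,d_X)$ is regarded as a coarse space with the bounded coarse structure $\mathcal{C}_X=\{E\subseteq X\times X : \sup_{(x,y)\in E}d_X(x,y)<\infty\}$; the same applies to $\mathbb{N}$ with its usual metric. A set $B\subseteq X$ is bounded if $B\times B\in\mathcal{C}_X$. Maps of pointed spaces $f\colon(X,\xi)\to(Y,\eta)$ satisfy $f(\xi)=\eta$. Such a map is proper if the inverse image of each bounded set of $Y$ containing $\eta$ is bounded in $X$; it is bornologous if $(f\times f)(E)\in\mathcal{C}_Y$ for all $E\in\mathcal{C}_X$; it is coarse if it is proper and bornologous. The invariant $\iota$: for $x,y\in{}^{\ast}X$ write $x\sim_X y$ if $(x,y)\in{}^{\ast}E$ for some $E\in\mathcal{C}_X$ (here: if ${}^{\ast}d_X(x,y)$ is finite). Let $\mathrm{INF}(X,\xi)=\{x\in{}^{\ast}X : x\not\sim_X\xi\}$. For $x,y\in\mathrm{INF}(X,\xi)$ write $x\equiv^{\iota}_{X,\xi}y$ if there are $n\in{}^{\ast}\mathbb{N}$ and an internal hyperfinite sequence $\{s_i\}_{i\le n}$ of points of $\mathrm{INF}(X,\xi)$ with $s_0=x$, $s_n=y$ and $s_i\sim_X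 s_{i+1}$ for all $i<n$. This is an equivalence relation; $[x]^{\iota}_{X,\xi}$ denotes the class of $x$, and $\iota(X,\xi)=\{[x]^{\iota}_{X,\xi} : x\in\mathrm{INF}(X,\xi)\}$. The invariant $\sigma$: a coarse sequence on $X$ based at $\xi$ is a coarse map $s\colon(\mathbb{N},0)\to(X,\xi)$; $S(X,\xi)$ is the set of these. For $s,t\in S(X,\xi)$ write $s\sqsubseteq t$ if $s=t\circ\kappa$ for some strictly monotone $\kappa\colon\mathbb{N}\to\mathbb{N}$. Let $\equiv^{\sigma}_{X,\xi}$ be the smallest equivalence relation on $S(X,\xi)$ containing $\sqsubseteq$, let $[s]^{\sigma}_{X,\xi}$ be the class of $s$, and $\sigma(X,\xi)=\{[s]^{\sigma}_{X,\xi} : s\in S(X,\xi)\}$. The map $\omega_{(X,\xi)}$ is defined by $\omega_{(X,\xi)}([s]^{\sigma}_{X,\xi})=[{}^{\ast}s_{\omega}]^{\iota}_{X,\xi}$, where $\omega\in{}^{\ast}\mathbb{N}\setminus\mathbb{N}$ is any infinite hypernatural number; this is well-defined and independent of the choice of $s$ in its class and of $\omega$. *)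

theory Defs
  imports "HOL-Analysis.Analysis"
begin

section \<open>Nonstandard universes\<close>

text \<open>
  A standard universe (the superstructure over a set of atoms, with membership \<open>Mem\<close>), a
  nonstandard universe (with membership \<open>NMem\<close>) and the extension map \<open>Star\<close> between them.
  \<open>num\<close> names the natural numbers inside the standard universe.  No particular coding of the
  numbers is fixed; they may, for instance, be atoms.  Neither \<open>NMem\<close> nor the type \<open>'v\<close> is
  otherwise constrained: \<open>'v\<close> may consist of the internal objects only or be a superstructure
  that contains external sets as well.

  The superstructure is \<open>V\<^sub>h\<close> for \<open>h = height W\<close>.  For \<open>h = \<infinity>\<close> this is the usual
  superstructure, the union of all the finite levels.  Finite heights are admitted too, because
  the usual superstructure over an infinite set is larger than every type that HOL proves to
  exist; facts about all heights cover the usual case.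
\<close>

record ('u, 'v) universe =
  Atoms :: "'u set"
  height :: enat
  Mem :: "'u \<Rightarrow> 'u \<Rightarrow> bool"
  num :: "nat \<Rightarrow> 'u"
  NMem :: "'v \<Rightarrow> 'v \<Rightarrow> bool"
  Star :: "'u \<Rightarrow> 'v"

primrec level :: "('u, 'v) universe \<Rightarrow> nat \<Rightarrow> 'u set" where
  "level W 0 = Atoms W"
| "level W (Suc n) = level W n \<union> {a. a \<notin> Atoms W \<and> {x. Mem W x a} \<subseteq> level W n}"

definition superstructure :: "('u, 'v) universe \<Rightarrow> bool" where
  "superstructure W \<longleftrightarrow>
     (\<forall>a\<in>Atoms W. \<forall>x. \<not> Mem W x a) \<and>
     (\<forall>a b. a \<notin> Atoms W \<longrightarrow> b \<notin> Atoms W \<longrightarrow> (\<forall>x. Mem W x a \<longleftrightarrow> Mem W x b) \<longrightarrow> a = b) \<and>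
     (\<Union>n\<in>{n. enat n \<le> height W}. level W n) = UNIV \<and>
     (\<forall>n A. enat n < height W \<longrightarrow> A \<subseteq> level W n \<longrightarrow>
        (\<exists>a. a \<notin> Atoms W \<and> {x. Mem W x a} = A))"

text \<open>
  \<open>A\<close> is a subset of the universe with room for a few power sets above it.  At height \<open>\<infinity>\<close>
  this says exactly that \<open>A\<close> is the extension of a set in the superstructure.
\<close>

definition lives_in :: "'u set \<Rightarrow> ('u, 'v) universe \<Rightarrow> bool" where
  "lives_in A W \<longleftrightarrow> (\<exists>k. A \<subseteq> level W k \<and> enat (k + 5) \<le> height W)"

text \<open>
  Bounded formulas of set theory: variables are natural numbers, and
  \<open>All_in i j \<phi>\<close> is \<open>\<forall>v\<^sub>i\<in>v\<^sub>j. \<phi>\<close>.  The values of the free variables serve as parameters.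
\<close>

datatype bounded_formula =
    Equal nat nat
  | Elem nat nat
  | Neg bounded_formula
  | Conj bounded_formula bounded_formula
  | All_in nat nat bounded_formula

primrec holds :: "('a \<Rightarrow> 'a \<Rightarrow> bool) \<Rightarrow> bounded_formula \<Rightarrow> (nat \<Rightarrow> 'a) \<Rightarrow> bool" where
  "holds E (Equal i j) e \<longleftrightarrow> e i = e j"
| "holds E (Elem i j) e \<longleftrightarrow> E (e i) (e j)"
| "holds E (Neg p) e \<longleftrightarrow> \<not> holds E p e"
| "holds E (Conj p q) e \<longleftrightarrow> holds E p e \<and> holds E q e"
| "holds E (All_in i j p) e \<longleftrightarrow> (\<forall>a. E a (e j) \<longrightarrow> holds E p (e(i := a)))"

definition transfer_principle :: "('u, 'v) universe \<Rightarrow> bool" where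
  "transfer_principle W \<longleftrightarrow>
     (\<forall>p e. holds (Mem W) p e \<longleftrightarrow> holds (NMem W) p (\<lambda>i. Star W (e i)))"

definition internal :: "('u, 'v) universe \<Rightarrow> 'v \<Rightarrow> bool" where
  "internal W v \<longleftrightarrow> (\<exists>A. NMem W v (Star W A))"

definition saturation_principle :: "('u, 'v) universe \<Rightarrow> bool" where
  "saturation_principle W \<longleftrightarrow>
     (\<forall>I F. I \<notin> Atoms W \<longrightarrow>
        (\<forall>i. Mem W i I \<longrightarrow> internal W (F i)) \<longrightarrow>
        (\<forall>J. finite J \<longrightarrow> J \<subseteq> {i. Mem W i I} \<longrightarrow> (\<exists>v. \<forall>i\<in>J. NMem W v (F i))) \<longrightarrow>
        (\<exists>v. \<forall>i. Mem W i I \<longrightarrow> NMem W v (F i)))"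

definition nonstandard_universe :: "('u, 'v) universe \<Rightarrow> bool" where
  "nonstandard_universe W \<longleftrightarrow>
     superstructure W \<and> inj (num W) \<and> lives_in (range (num W)) W \<and>
     transfer_principle W \<and> saturation_principle W"

subsection \<open>Extensions of sets, relations and sequences\<close>

text \<open>
  \<open>p\<close> is the Kuratowski pair of \<open>a\<close> and \<open>b\<close> with respect to the membership relation \<open>E\<close>.
\<close>

definition is_upair :: "('a \<Rightarrow> 'a \<Rightarrow> bool) \<Rightarrow> 'a \<Rightarrow> 'a \<Rightarrow> 'a \<Rightarrow> bool" where
  "is_upair E z a b \<longleftrightarrow> (\<forall>t. E t z \<longleftrightarrow> t = a \<or> t = b)"

definition is_pair :: "('a \<Rightarrow> 'a \<Rightarrow> bool) \<Rightarrow> 'a \<Rightarrow> 'a \<Rightarrow> 'a \<Rightarrow> bool" where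
  "is_pair E p a b \<longleftrightarrow> (\<exists>c e. is_upair E c a a \<and> is_upair E e a b \<and> is_upair E p c e)"

text \<open>The element of the standard universe that represents a set, or a relation, in the sense of HOL.\<close>

definition code_set :: "('u, 'v) universe \<Rightarrow> 'u set \<Rightarrow> 'u" where
  "code_set W A = (THE a. a \<notin> Atoms W \<and> {x. Mem W x a} = A)"

definition code_rel :: "('u, 'v) universe \<Rightarrow> ('u \<times> 'u) set \<Rightarrow> 'u" where
  "code_rel W R = code_set W {p. \<exists>x y. (x, y) \<in> R \<and> is_pair (Mem W) p x y}"

definition star_set :: "('u, 'v) universe \<Rightarrow> 'u set \<Rightarrow> 'v set" where
  "star_set W A = {v. NMem W v (Star W (code_set W A))}"

definition star_rel :: "('u, 'v) universe \<Rightarrow> ('u \<times> 'u) set \<Rightarrow> ('v \<times> 'v) set" where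
  "star_rel W R =
     {(v, w). \<exists>p. NMem W p (Star W (code_rel W R)) \<and> is_pair (NMem W) p v w}"

definition hypernat :: "('u, 'v) universe \<Rightarrow> 'v set" where
  "hypernat W = star_set W (range (num W))"

definition infinite_hypernat :: "('u, 'v) universe \<Rightarrow> 'v set" where
  "infinite_hypernat W = hypernat W - range (\<lambda>n. Star W (num W n))"

definition hypernat_le :: "('u, 'v) universe \<Rightarrow> ('v \<times> 'v) set" where
  "hypernat_le W = star_rel W {(num W m, num W n) | m n. m \<le> n}"

definition hypernat_less :: "('u, 'v) universe \<Rightarrow> ('v \<times> 'v) set" where
  "hypernat_less W = star_rel W {(num W m, num W n) | m n. m < n}"

definition hypernat_succ :: "('u, 'v) universe \<Rightarrow> ('v \<times> 'v) set" where
  "hypernat_succ W = star_rel W {(num W m, num W (Suc m)) | m. True}"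

text \<open>The value at the hypernatural \<open>w\<close> of the extension of a standard sequence \<open>s\<close>.\<close>

definition star_seq :: "('u, 'v) universe \<Rightarrow> (nat \<Rightarrow> 'u) \<Rightarrow> 'v \<Rightarrow> 'v" where
  "star_seq W s w = (THE x. (w, x) \<in> star_rel W {(num W n, s n) | n. True})"

text \<open>The sequence \<open>t\<close>, restricted to the hypernaturals \<open>i \<le> n\<close>, is an internal function \<open>f\<close>.\<close>

definition internal_sequence :: "('u, 'v) universe \<Rightarrow> 'v \<Rightarrow> ('v \<Rightarrow> 'v) \<Rightarrow> bool" where
  "internal_sequence W n t \<longleftrightarrow>
     (\<exists>f. internal W f \<and>
        (\<forall>p. NMem W p f \<longrightarrow> (\<exists>i x. is_pair (NMem W) p i x)) \<and>
        {(i, x). \<exists>p. NMem W p f \<and> is_pair (NMem W) p i x} =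
        {(i, t i) | i. i \<in> hypernat W \<and> (i, n) \<in> hypernat_le W})"

section \<open>Metric and coarse notions\<close>

definition proper_metric :: "'a set \<Rightarrow> ('a \<Rightarrow> 'a \<Rightarrow> real) \<Rightarrow> bool" where
  "proper_metric M d \<longleftrightarrow>
     (\<forall>S. closedin (Metric_space.mtopology M d) S \<and> Metric_space.mbounded M d S \<longrightarrow>
          compactin (Metric_space.mtopology M d) S)"

definition geodesic_metric :: "'a set \<Rightarrow> ('a \<Rightarrow> 'a \<Rightarrow> real) \<Rightarrow> bool" where
  "geodesic_metric M d \<longleftrightarrow>
     (\<forall>x\<in>M. \<forall>y\<in>M. \<exists>g :: real \<Rightarrow> 'a.
        g 0 = x \<and> g (d x y) = y \<and> g ` {0..d x y} \<subseteq> M \<and>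
        (\<forall>s\<in>{0..d x y}. \<forall>t\<in>{0..d x y}. d (g s) (g t) = \<bar>s - t\<bar>))"

text \<open>Boundedness above, rather than \<open>Sup\<close>, so that the empty relation is controlled.\<close>

definition bounded_coarse :: "'a set \<Rightarrow> ('a \<Rightarrow> 'a \<Rightarrow> real) \<Rightarrow> ('a \<times> 'a) set set" where
  "bounded_coarse M d = {E. E \<subseteq> M \<times> M \<and> bdd_above ((\<lambda>(x, y). d x y) ` E)}"

definition coarse_bounded :: "('a \<times> 'a) set set \<Rightarrow> 'a set \<Rightarrow> bool" where
  "coarse_bounded C B \<longleftrightarrow> B \<times> B \<in> C"

definition bornologous :: "('a \<times> 'a) set set \<Rightarrow> ('b \<times> 'b) set set \<Rightarrow> ('a \<Rightarrow> 'b) \<Rightarrow> bool" where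
  "bornologous C D f \<longleftrightarrow> (\<forall>E\<in>C. map_prod f f ` E \<in> D)"

definition coarse_proper ::
    "'a set \<Rightarrow> ('a \<times> 'a) set set \<Rightarrow> ('b \<times> 'b) set set \<Rightarrow> 'b \<Rightarrow> ('a \<Rightarrow> 'b) \<Rightarrow> bool" where
  "coarse_proper M C D \<eta> f \<longleftrightarrow>
     (\<forall>B. coarse_bounded D B \<and> \<eta> \<in> B \<longrightarrow> coarse_bounded C (f -` B \<inter> M))"

definition nat_coarse :: "(nat \<times> nat) set set" where
  "nat_coarse = bounded_coarse UNIV (\<lambda>m n. \<bar>real m - real n\<bar>)"

subsection \<open>The invariant \<open>\<sigma>\<close>\<close>

definition coarse_seqs :: "'a set \<Rightarrow> ('a \<Rightarrow> 'a \<Rightarrow> real) \<Rightarrow> 'a \<Rightarrow> (nat \<Rightarrow> 'a) set" where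
  "coarse_seqs M d \<xi> =
     {s. range s \<subseteq> M \<and> s 0 = \<xi> \<and>
         coarse_proper UNIV nat_coarse (bounded_coarse M d) \<xi> s \<and>
         bornologous nat_coarse (bounded_coarse M d) s}"

definition subseq_of :: "(nat \<Rightarrow> 'a) \<Rightarrow> (nat \<Rightarrow> 'a) \<Rightarrow> bool" where
  "subseq_of s t \<longleftrightarrow> (\<exists>\<kappa>. strict_mono \<kappa> \<and> s = t \<circ> \<kappa>)"

definition sigma_rel ::
    "'a set \<Rightarrow> ('a \<Rightarrow> 'a \<Rightarrow> real) \<Rightarrow> 'a \<Rightarrow> ((nat \<Rightarrow> 'a) \<times> (nat \<Rightarrow> 'a)) set" where
  "sigma_rel M d \<xi> =
     \<Inter>{r. equiv (coarse_seqs M d \<xi>) r \<and>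
          {(s, t). s \<in> coarse_seqs M d \<xi> \<and> t \<in> coarse_seqs M d \<xi> \<and> subseq_of s t} \<subseteq> r}"

definition sigma_inv :: "'a set \<Rightarrow> ('a \<Rightarrow> 'a \<Rightarrow> real) \<Rightarrow> 'a \<Rightarrow> (nat \<Rightarrow> 'a) set set" where
  "sigma_inv M d \<xi> = coarse_seqs M d \<xi> // sigma_rel M d \<xi>"

subsection \<open>The invariant \<open>\<iota>\<close>\<close>

definition sim :: "('u, 'v) universe \<Rightarrow> 'u set \<Rightarrow> ('u \<Rightarrow> 'u \<Rightarrow> real) \<Rightarrow> 'v \<Rightarrow> 'v \<Rightarrow> bool" where
  "sim W M d x y \<longleftrightarrow> (\<exists>E\<in>bounded_coarse M d. (x, y) \<in> star_rel W E)"

definition INF_pts :: "('u, 'v) universe \<Rightarrow> 'u set \<Rightarrow> ('u \<Rightarrow> 'u \<Rightarrow> real) \<Rightarrow> 'u \<Rightarrow> 'v set" where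
  "INF_pts W M d \<xi> = {x \<in> star_set W M. \<not> sim W M d x (Star W \<xi>)}"

definition iota_rel ::
    "('u, 'v) universe \<Rightarrow> 'u set \<Rightarrow> ('u \<Rightarrow> 'u \<Rightarrow> real) \<Rightarrow> 'u \<Rightarrow> ('v \<times> 'v) set" where
  "iota_rel W M d \<xi> =
     {(x, y). x \<in> INF_pts W M d \<xi> \<and> y \<in> INF_pts W M d \<xi> \<and>
        (\<exists>n\<in>hypernat W. \<exists>t. internal_sequence W n t \<and>
           (\<forall>i\<in>hypernat W. (i, n) \<in> hypernat_le W \<longrightarrow> t i \<in> INF_pts W M d \<xi>) \<and>
           t (Star W (num W 0)) = x \<and> t n = y \<and>
           (\<forall>i j. (i, n) \<in> hypernat_less W \<longrightarrow> (i, j) \<in> hypernat_succ W \<longrightarrow>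
              sim W M d (t i) (t j)))}"

definition iota_inv :: "('u, 'v) universe \<Rightarrow> 'u set \<Rightarrow> ('u \<Rightarrow> 'u \<Rightarrow> real) \<Rightarrow> 'u \<Rightarrow> 'v set set" where
  "iota_inv W M d \<xi> = INF_pts W M d \<xi> // iota_rel W M d \<xi>"

subsection \<open>The comparison map\<close>

text \<open>
  The definite description reflects that the class does not depend on the choice of the
  representative \<open>s\<close> or of the infinite hypernatural \<open>w\<close>.
\<close>

definition omega_map ::
    "('u, 'v) universe \<Rightarrow> 'u set \<Rightarrow> ('u \<Rightarrow> 'u \<Rightarrow> real) \<Rightarrow> 'u \<Rightarrow> (nat \<Rightarrow> 'u) set \<Rightarrow> 'v set" where
  "omega_map W M d \<xi> c =
     (THE C. \<exists>s\<in>c. \<exists>w\<in>infinite_hypernat W. C = iota_rel W M d \<xi> `` {star_seq W s w})"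

end

theory Submission
  imports Defs
begin

text \<open>
  Let \<open>x\<close> be a point at infinite distance from \<open>\<xi>\<close>.  For every standard \<open>y\<close> a geodesic from
  \<open>\<xi>\<close> to \<open>y\<close>, continued by the constant \<open>y\<close>, is sampled at the natural numbers; this gives a
  standard family \<open>F y i\<close>, and the extension of \<open>F\<close> provides an internal sequence
  \<open>F x 0, F x 1, \<dots>\<close> from \<open>\<xi>\<close> to \<open>x\<close>.  The sets \<open>A\<close> with \<open>x\<close> in the extension of \<open>A\<close> form an
  ultrafilter on \<open>M\<close>.  The points \<open>F y n\<close> with \<open>n\<close> standard lie in a ball, which by properness has
  a finite \<open>1\<close>-net; so there is a standard point \<open>s n\<close> such that \<open>d (s n) (F y n) \<le> 1\<close> for almost
  all \<open>y\<close> (\<open>ex_coarse_seq\<close>).  As any two members of the ultrafilter meet, every statement on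
  finitely many values of \<open>s\<close> can be compared with a standard geodesic; in this way \<open>s\<close> is seen to
  be a coarse sequence.  By saturation there is an infinite \<open>w\<close> such that the value of the
  extension of \<open>s\<close> at \<open>w\<close> is still within \<open>1\<close> of \<open>F x w\<close> (\<open>overspill\<close>), and the remaining part of
  \<open>F x\<close> connects \<open>F x w\<close> with \<open>x\<close> through infinite points (\<open>connects_segment\<close>).

  The comparison map is given by a definite description, so it must also be shown that the class
  at an infinite index depends neither on the index nor on the representative
  (\<open>omega_map_class\<close>).  Between two infinite indices the extension of a coarse sequence is itself
  an admissible internal path, and a subsequence takes at \<open>w\<close> the value of the whole sequence at
  another infinite index.  That \<open>iota_rel\<close> is an equivalence relation follows from a single
  construction, the concatenation of a path with the reverse of another one (\<open>connects_join\<close>).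

  Every use of the transfer principle names a bounded formula explicitly.
\<close>

section \<open>Bounded formulas for pairs and relations\<close>

text \<open>
  The pair of \<open>x\<close> and \<open>y\<close> belongs to \<open>r\<close>.  This notion and its companions below take the
  membership relation \<open>E\<close> as an argument, so that one formula expresses them in the standard and
  in the nonstandard universe alike.
\<close>

definition rel :: "('a \<Rightarrow> 'a \<Rightarrow> bool) \<Rightarrow> 'a \<Rightarrow> 'a \<Rightarrow> 'a \<Rightarrow> bool" where
  "rel E r x y \<longleftrightarrow> (\<exists>p. E p r \<and> is_pair E p x y)"

text \<open>
  The triple of \<open>x\<close>, \<open>y\<close> and \<open>z\<close>, coded as the pair of \<open>x\<close> with the pair of \<open>y\<close> and \<open>z\<close>,
  belongs to \<open>r\<close>.
\<close>

definition rel3 :: "('a \<Rightarrow> 'a \<Rightarrow> bool) \<Rightarrow> 'a \<Rightarrow> 'a \<Rightarrow> 'a \<Rightarrow> 'a \<Rightarrow> bool" where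
  "rel3 E r x y z \<longleftrightarrow> (\<exists>p q. E p r \<and> is_pair E p x q \<and> is_pair E q y z)"

text \<open>
  Extensionality of \<open>E\<close> is not needed here; it may fail for the membership of the nonstandard
  universe.
\<close>

lemma is_pair_inject:
  assumes "is_pair E p a b" "is_pair E p a' b'"
  shows "a = a' \<and> b = b'"
  using assms unfolding is_pair_def is_upair_def by metis

definition Disj :: "bounded_formula \<Rightarrow> bounded_formula \<Rightarrow> bounded_formula" where
  "Disj p q = Neg (Conj (Neg p) (Neg q))"

definition Imp :: "bounded_formula \<Rightarrow> bounded_formula \<Rightarrow> bounded_formula" where
  "Imp p q = Neg (Conj p (Neg q))"

definition Iff :: "bounded_formula \<Rightarrow> bounded_formula \<Rightarrow> bounded_formula" where
  "Iff p q = Conj (Imp p q) (Imp q p)"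

definition Ex_in :: "nat \<Rightarrow> nat \<Rightarrow> bounded_formula \<Rightarrow> bounded_formula" where
  "Ex_in i j p = Neg (All_in i j (Neg p))"

lemma holds_connectives [simp]:
  "holds E (Disj p q) e \<longleftrightarrow> holds E p e \<or> holds E q e"
  "holds E (Imp p q) e \<longleftrightarrow> (holds E p e \<longrightarrow> holds E q e)"
  "holds E (Iff p q) e \<longleftrightarrow> (holds E p e \<longleftrightarrow> holds E q e)"
  "holds E (Ex_in i j p) e \<longleftrightarrow> (\<exists>a. E a (e j) \<and> holds E p (e(i := a)))"
  by (auto simp: Disj_def Imp_def Iff_def Ex_in_def)

text \<open>
  In the following formulas each bound variable exceeds the sum of the free ones.  Hence it
  differs from all of them, and the descriptions of what the formulas express need no side
  condition on variables.
\<close>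

text \<open>
  \<open>UpairF z a b\<close>, \<open>PairF p a b\<close>, \<open>RelF r x y\<close> and \<open>Rel3F r x y z\<close> express \<open>is_upair\<close>,
  \<open>is_pair\<close>, \<open>rel\<close> and \<open>rel3\<close>.  The quantifiers over the components of a pair become bounded
  because these are members, or members of members, of the pair.
\<close>

definition UpairF :: "nat \<Rightarrow> nat \<Rightarrow> nat \<Rightarrow> bounded_formula" where
  "UpairF z a b = (let t = Suc (z + a + b) in
     Conj (Elem a z) (Conj (Elem b z) (All_in t z (Disj (Equal t a) (Equal t b)))))"

definition PairF :: "nat \<Rightarrow> nat \<Rightarrow> nat \<Rightarrow> bounded_formula" where
  "PairF p a b = (let c = Suc (p + a + b); e = Suc c in
     Ex_in c p (Ex_in e p (Conj (UpairF c a a) (Conj (UpairF e a b) (UpairF p c e)))))"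

definition RelF :: "nat \<Rightarrow> nat \<Rightarrow> nat \<Rightarrow> bounded_formula" where
  "RelF r x y = (let p = Suc (r + x + y) in Ex_in p r (PairF p x y))"

definition Rel3F :: "nat \<Rightarrow> nat \<Rightarrow> nat \<Rightarrow> nat \<Rightarrow> bounded_formula" where
  "Rel3F r x y z = (let p = Suc (r + x + y + z); e = Suc p; q = Suc e in
     Ex_in p r (Ex_in e p (Ex_in q e (Conj (PairF p x q) (PairF q y z)))))"

lemma holds_UpairF [simp]: "holds E (UpairF z a b) e \<longleftrightarrow> is_upair E (e z) (e a) (e b)"
  by (auto simp: UpairF_def is_upair_def Let_def)

lemma holds_PairF [simp]: "holds E (PairF p a b) e \<longleftrightarrow> is_pair E (e p) (e a) (e b)"
  by (auto simp: PairF_def is_pair_def Let_def) (auto simp: is_upair_def)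

lemma holds_RelF [simp]: "holds E (RelF r x y) e \<longleftrightarrow> rel E (e r) (e x) (e y)"
  by (auto simp: RelF_def rel_def Let_def)

lemma holds_Rel3F [simp]: "holds E (Rel3F r x y z) e \<longleftrightarrow> rel3 E (e r) (e x) (e y) (e z)"
proof -
  have *: "\<exists>c. E c p \<and> E q c" if "is_pair E p x q" for p x q
    using that unfolding is_pair_def is_upair_def by blast
  have "holds E (Rel3F r x y z) e \<longleftrightarrow> (\<exists>p. E p (e r) \<and> (\<exists>c. E c p \<and>
      (\<exists>q. E q c \<and> is_pair E p (e x) q \<and> is_pair E q (e y) (e z))))"
    by (simp add: Rel3F_def Let_def)
  also have "\<dots> \<longleftrightarrow> rel3 E (e r) (e x) (e y) (e z)"
    unfolding rel3_def by (blast dest: *)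
  finally show ?thesis .
qed

text \<open>
  \<open>f\<close> is the graph of a function from \<open>{i \<in> N. i \<le> n}\<close> to \<open>X\<close>, where the order is the relation
  \<open>L\<close>.
\<close>

definition path_graph :: "('a \<Rightarrow> 'a \<Rightarrow> bool) \<Rightarrow> 'a \<Rightarrow> 'a \<Rightarrow> 'a \<Rightarrow> 'a \<Rightarrow> 'a \<Rightarrow> bool" where
  "path_graph E N X L f n \<longleftrightarrow>
     (\<forall>p. E p f \<longrightarrow> (\<exists>i. E i N \<and> (\<exists>x. E x X \<and> is_pair E p i x))) \<and>
     (\<forall>i. E i N \<longrightarrow> (rel E L i n \<longleftrightarrow> (\<exists>x. E x X \<and> rel E f i x))) \<and>
     (\<forall>i. E i N \<longrightarrow> (\<forall>x. E x X \<longrightarrow> (\<forall>y. E y X \<longrightarrow> rel E f i x \<longrightarrow> rel E f i y \<longrightarrow> x = y)))"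

definition PathF :: "nat \<Rightarrow> nat \<Rightarrow> nat \<Rightarrow> nat \<Rightarrow> nat \<Rightarrow> bounded_formula" where
  "PathF N X L f n = (let i = Suc (N + X + L + f + n); x = Suc i; y = Suc x in
     Conj (All_in y f (Ex_in i N (Ex_in x X (PairF y i x))))
    (Conj (All_in i N (Iff (RelF L i n) (Ex_in x X (RelF f i x))))
          (All_in i N (All_in x X (All_in y X
             (Imp (RelF f i x) (Imp (RelF f i y) (Equal x y))))))))"

lemma holds_PathF [simp]:
  "holds E (PathF N X L f n) e \<longleftrightarrow> path_graph E (e N) (e X) (e L) (e f) (e n)"
  by (simp add: PathF_def path_graph_def Let_def)

section \<open>Coding sets and relations\<close>

lemma level_mono:
  assumes "m \<le> n"
  shows "level W m \<subseteq> level W n"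
  using assms by (induct n rule: dec_induct) (simp_all only: level.simps, blast+)

text \<open>
  This rule stands in for the defining equation of the successor levels, which makes the
  simplifier diverge and is removed from it below.
\<close>

lemma level_SucI: "a \<notin> Atoms W \<Longrightarrow> (\<And>x. Mem W x a \<Longrightarrow> x \<in> level W n) \<Longrightarrow> a \<in> level W (Suc n)"
  by (simp only: level.simps) blast

declare level.simps [simp del]

text \<open>
  Numbers, and later points, lie in level \<open>k\<close>, with five levels of room above it.  All five are
  used: relations between elements of level \<open>k\<close> are coded in level \<open>k + 3\<close>, sets of such relations
  in level \<open>k + 4\<close>, and ternary relations in level \<open>k + 5\<close>.
\<close>

locale coded_universe =
  fixes W :: "('u, 'v) universe" and k :: nat
  assumes universe: "nonstandard_universe W"
    and num_level: "range (num W) \<subseteq> level W k"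
    and height: "enat (k + 5) \<le> height W"
begin

lemma inj_num: "inj (num W)"
  and sat: "saturation_principle W"
  and superstructure: "superstructure W"
  using universe by (auto simp: nonstandard_universe_def)

lemma num_eq_iff [simp]: "num W m = num W n \<longleftrightarrow> m = n"
  using inj_num by (auto dest: injD)

text \<open>
  Applications use environments of the form \<open>\<lambda>i. xs ! i\<close>: the first variables name the parameters
  of the formula, in the order of the list \<open>xs\<close>, and larger numbers serve as bound variables.
\<close>

lemma transfer: "holds (Mem W) p e \<longleftrightarrow> holds (NMem W) p (\<lambda>i. Star W (e i))"
  using universe by (auto simp: nonstandard_universe_def transfer_principle_def)

lemma not_atom: "Mem W x a \<Longrightarrow> a \<notin> Atoms W"
  and code_unique: "\<lbrakk>a \<notin> Atoms W; b \<notin> Atoms W; \<And>x. Mem W x a \<longleftrightarrow> Mem W x b\<rbrakk> \<Longrightarrow> a = b"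
  and ex_code_height:
    "\<lbrakk>enat n < height W; A \<subseteq> level W n\<rbrakk> \<Longrightarrow> \<exists>a. a \<notin> Atoms W \<and> {x. Mem W x a} = A"
  using superstructure unfolding superstructure_def by (metis, metis, metis)

lemma ex_code:
  assumes "A \<subseteq> level W n" "n \<le> k + 4"
  shows "\<exists>a. a \<notin> Atoms W \<and> {x. Mem W x a} = A"
proof -
  have "enat n < enat (k + 5)" using assms(2) by simp
  also note height
  finally show ?thesis
    using assms(1) by (rule ex_code_height)
qed

lemma code_set:
  assumes "A \<subseteq> level W n" "n \<le> k + 4"
  shows "code_set W A \<notin> Atoms W" "Mem W x (code_set W A) \<longleftrightarrow> x \<in> A"
proof -
  have "\<exists>!a. a \<notin> Atoms W \<and> {x. Mem W x a} = A"
    using ex_code[OF assms] code_unique by (elim exE, intro ex1I) auto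
  then have *: "code_set W A \<notin> Atoms W \<and> {x. Mem W x (code_set W A)} = A"
    unfolding code_set_def by (rule theI')
  then show "code_set W A \<notin> Atoms W" "Mem W x (code_set W A) \<longleftrightarrow> x \<in> A"
    by blast+
qed

lemma upair_level:
  assumes "is_upair (Mem W) z a b" "a \<in> level W n" "b \<in> level W n"
  shows "z \<in> level W (Suc n)"
  using assms not_atom[of a z] by (intro level_SucI) (auto simp: is_upair_def)

lemma pair_level:
  assumes "is_pair (Mem W) p a b" "a \<in> level W n" "b \<in> level W n"
  shows "p \<in> level W (n + 2)"
  using assms upair_level unfolding is_pair_def by (simp, blast)

lemma ex_upair:
  assumes "a \<in> level W n" "b \<in> level W n" "n \<le> k + 4"
  shows "\<exists>z. is_upair (Mem W) z a b"
  using code_set(2)[of "{a, b}" n] assms unfolding is_upair_def by auto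

lemma ex_pair:
  assumes "a \<in> level W n" "b \<in> level W n" "n \<le> k + 3"
  shows "\<exists>p. is_pair (Mem W) p a b"
proof -
  obtain c e where *: "is_upair (Mem W) c a a" "is_upair (Mem W) e a b"
    using ex_upair[of a n a] ex_upair[of a n b] assms by force
  then have "c \<in> level W (Suc n)" "e \<in> level W (Suc n)"
    using assms upair_level by blast+
  then obtain p where "is_upair (Mem W) p c e"
    using ex_upair[of c "Suc n" e] assms(3) by force
  with * show ?thesis unfolding is_pair_def by blast
qed

lemma code_rel:
  assumes "R \<subseteq> level W n \<times> level W n" "n \<le> k + 2"
  shows "code_rel W R \<notin> Atoms W"
    "Mem W p (code_rel W R) \<longleftrightarrow> (\<exists>x y. (x, y) \<in> R \<and> is_pair (Mem W) p x y)"
    "rel (Mem W) (code_rel W R) x y \<longleftrightarrow> (x, y) \<in> R"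
proof -
  have *: "{p. \<exists>x y. (x, y) \<in> R \<and> is_pair (Mem W) p x y} \<subseteq> level W (n + 2)"
    using assms pair_level by blast
  show "code_rel W R \<notin> Atoms W"
    and mem: "\<And>p. Mem W p (code_rel W R) \<longleftrightarrow> (\<exists>x y. (x, y) \<in> R \<and> is_pair (Mem W) p x y)"
    using code_set(1,2)[OF *] assms(2) unfolding code_rel_def by auto
  show "rel (Mem W) (code_rel W R) x y \<longleftrightarrow> (x, y) \<in> R"
  proof
    show "rel (Mem W) (code_rel W R) x y \<Longrightarrow> (x, y) \<in> R"
      using is_pair_inject by (fastforce simp: rel_def mem)
    assume "(x, y) \<in> R"
    then show "rel (Mem W) (code_rel W R) x y"
      using ex_pair[of x n y] assms by (auto simp: rel_def mem)
  qed
qed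

text \<open>
  The code of a ternary relation, in agreement with the coding of triples in \<open>rel3\<close>.
\<close>

definition code_rel3 :: "('u \<times> 'u \<times> 'u) set \<Rightarrow> 'u" where
  "code_rel3 R = code_rel W {(x, q). \<exists>y z. (x, y, z) \<in> R \<and> is_pair (Mem W) q y z}"

lemma rel3_code:
  assumes "R \<subseteq> level W k \<times> level W k \<times> level W k"
  shows "rel3 (Mem W) (code_rel3 R) x y z \<longleftrightarrow> (x, y, z) \<in> R"
proof -
  let ?R = "{(x, q). \<exists>y z. (x, y, z) \<in> R \<and> is_pair (Mem W) q y z}"
  have "?R \<subseteq> level W (k + 2) \<times> level W (k + 2)"
  proof
    fix p assume "p \<in> ?R"
    then obtain x q y z where p: "p = (x, q)" "(x, y, z) \<in> R" "is_pair (Mem W) q y z"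
      by auto
    then have "x \<in> level W k" "y \<in> level W k" "z \<in> level W k"
      using assms by auto
    with p show "p \<in> level W (k + 2) \<times> level W (k + 2)"
      using pair_level[of q y z k] level_mono[of k "k + 2" W] by (auto simp del: level.simps add_2_eq_Suc')
  qed
  then have R: "rel (Mem W) (code_rel3 R) x q \<longleftrightarrow> (x, q) \<in> ?R" for x q
    unfolding code_rel3_def by (rule code_rel) simp
  have "rel3 (Mem W) (code_rel3 R) x y z \<longleftrightarrow>
      (\<exists>q. rel (Mem W) (code_rel3 R) x q \<and> is_pair (Mem W) q y z)"
    unfolding rel3_def rel_def by blast
  also have "\<dots> \<longleftrightarrow> (x, y, z) \<in> R"
  proof
    show "\<exists>q. rel (Mem W) (code_rel3 R) x q \<and> is_pair (Mem W) q y z \<Longrightarrow> (x, y, z) \<in> R"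
      unfolding R by (auto dest: is_pair_inject)
    assume "(x, y, z) \<in> R"
    moreover from this obtain q where "is_pair (Mem W) q y z"
      using ex_pair[of y k z] assms by auto
    ultimately show "\<exists>q. rel (Mem W) (code_rel3 R) x q \<and> is_pair (Mem W) q y z"
      unfolding R by blast
  qed
  finally show ?thesis .
qed

section \<open>Extensions of sets and relations\<close>

lemma mem_code: "A \<subseteq> level W (k + 4) \<Longrightarrow> Mem W x (code_set W A) \<longleftrightarrow> x \<in> A"
  using code_set(2)[of A "k + 4"] by simp

lemma level_k_subset: "A \<subseteq> level W k \<Longrightarrow> A \<subseteq> level W (k + 4)"
  using level_mono[of k "k + 4" W] by auto

lemma mem_code_small: "A \<subseteq> level W k \<Longrightarrow> Mem W x (code_set W A) \<longleftrightarrow> x \<in> A"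
  by (simp add: mem_code level_k_subset)

lemma star_set_iff: "v \<in> star_set W A \<longleftrightarrow> NMem W v (Star W (code_set W A))"
  by (simp add: star_set_def)

lemma star_set_Un:
  assumes "A \<subseteq> B \<union> C" "B \<subseteq> level W (k + 4)" "C \<subseteq> level W (k + 4)"
  shows "star_set W A \<subseteq> star_set W B \<union> star_set W C"
proof -
  have "A \<subseteq> level W (k + 4)" using assms by blast
  then have "holds (Mem W) (All_in 3 0 (Disj (Elem 3 1) (Elem 3 2)))
      (\<lambda>i. [code_set W A, code_set W B, code_set W C] ! i)"
    using assms by (auto simp: mem_code)
  then show ?thesis
    unfolding transfer by (auto simp: star_set_iff)
qed

lemma star_set_mono: "A \<subseteq> B \<Longrightarrow> B \<subseteq> level W (k + 4) \<Longrightarrow> star_set W A \<subseteq> star_set W B"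
  using star_set_Un[of A B B] by simp

lemma star_set_Int:
  assumes "A \<subseteq> level W k" "B \<subseteq> level W k" "v \<in> star_set W A" "v \<in> star_set W B"
  shows "v \<in> star_set W (A \<inter> B)"
proof -
  have "A \<inter> B \<subseteq> level W k" using assms by blast
  then have "holds (Mem W) (All_in 3 0 (Imp (Elem 3 1) (Elem 3 2)))
      (\<lambda>i. [code_set W A, code_set W B, code_set W (A \<inter> B)] ! i)"
    using assms by (auto simp: mem_code_small)
  then show ?thesis
    unfolding transfer using assms by (auto simp: star_set_iff)
qed

lemma star_set_empty: "star_set W {} = {}"
proof -
  have "holds (Mem W) (All_in 1 0 (Neg (Equal 1 1))) (\<lambda>i. [code_set W {}] ! i)"
    by (auto simp: mem_code)
  then show ?thesis
    unfolding transfer by (auto simp: star_set_iff)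
qed

lemma Star_in_star_set:
  assumes "A \<subseteq> level W k"
  shows "Star W a \<in> star_set W A \<longleftrightarrow> a \<in> A"
  using transfer[of "Elem 0 1" "\<lambda>i. [a, code_set W A] ! i"] assms
  by (simp add: star_set_iff mem_code_small)

lemma star_set_singleton:
  assumes "a \<in> level W k" "v \<in> star_set W {a}"
  shows "v = Star W a"
proof -
  have "holds (Mem W) (All_in 2 0 (Equal 2 1)) (\<lambda>i. [code_set W {a}, a] ! i)"
    using assms by (auto simp: mem_code_small)
  then show ?thesis
    unfolding transfer using assms by (auto simp: star_set_iff)
qed

text \<open>
  The sets whose extension contains a given point form an ultrafilter: together with
  \<open>star_set_mono\<close>, \<open>star_set_Int\<close> and \<open>star_set_empty\<close> this covers the properties needed.
\<close>

lemma star_set_finite_UN: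
  assumes "finite I" "A \<subseteq> (\<Union>i\<in>I. B i)" "\<And>i. i \<in> I \<Longrightarrow> B i \<subseteq> level W k" "v \<in> star_set W A"
  shows "\<exists>i\<in>I. v \<in> star_set W (B i)"
  using assms
proof (induction I arbitrary: A rule: finite_induct)
  case empty
  then show ?case using star_set_empty by auto
next
  case (insert i I)
  have "(\<Union>j\<in>I. B j) \<subseteq> level W (k + 4)" "B i \<subseteq> level W (k + 4)"
    using insert.prems(2) level_k_subset by blast+
  then have "v \<in> star_set W (B i) \<or> v \<in> star_set W (\<Union>j\<in>I. B j)"
    using star_set_Un[of A "B i" "\<Union>j\<in>I. B j"] insert.prems by auto
  then show ?case using insert.IH[of "\<Union>j\<in>I. B j"] insert.prems by auto
qed

lemma star_rel_iff: "(v, w) \<in> star_rel W R \<longleftrightarrow> rel (NMem W) (Star W (code_rel W R)) v w"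
  by (simp add: star_rel_def rel_def)

lemma rel_code:
  assumes "R \<subseteq> level W k \<times> level W k"
  shows "rel (Mem W) (code_rel W R) x y \<longleftrightarrow> (x, y) \<in> R"
  using code_rel(3)[of R k] assms by simp

lemma star_rel_Star:
  assumes "R \<subseteq> level W k \<times> level W k"
  shows "(Star W a, Star W b) \<in> star_rel W R \<longleftrightarrow> (a, b) \<in> R"
  using transfer[of "RelF 0 1 2" "\<lambda>i. [code_rel W R, a, b] ! i"] assms
  by (simp add: star_rel_iff rel_code)

lemma star_rel_mono:
  assumes "R \<subseteq> S" "S \<subseteq> level W k \<times> level W k"
  shows "star_rel W R \<subseteq> star_rel W S"
proof -
  have *: "{p. \<exists>x y. (x, y) \<in> S \<and> is_pair (Mem W) p x y} \<subseteq> level W (k + 2)"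
    using assms pair_level by blast
  then have "star_set W {p. \<exists>x y. (x, y) \<in> R \<and> is_pair (Mem W) p x y} \<subseteq>
      star_set W {p. \<exists>x y. (x, y) \<in> S \<and> is_pair (Mem W) p x y}"
    using assms level_mono[of "k + 2" "k + 4" W] by (intro star_set_mono) force+
  then show ?thesis
    unfolding star_rel_def code_rel_def star_set_def by blast
qed

lemma star_rel_dom:
  assumes "R \<subseteq> A \<times> B" "A \<subseteq> level W k" "B \<subseteq> level W k"
  shows "star_rel W R \<subseteq> star_set W A \<times> star_set W B"
proof -
  have R: "R \<subseteq> level W k \<times> level W k" using assms by blast
  have "holds (Mem W) (All_in 3 0 (Ex_in 4 1 (Ex_in 5 2 (PairF 3 4 5))))
      (\<lambda>i. [code_rel W R, code_set W A, code_set W B] ! i)"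
    using assms code_rel(2)[OF R] by (auto simp: mem_code_small)
  then have "\<forall>p. NMem W p (Star W (code_rel W R)) \<longrightarrow>
      (\<exists>x. x \<in> star_set W A \<and> (\<exists>y. y \<in> star_set W B \<and> is_pair (NMem W) p x y))"
    unfolding transfer by (simp add: star_set_iff)
  then show ?thesis
    unfolding star_rel_def by (auto dest: is_pair_inject)
qed

lemma star_rel_converse:
  assumes "R \<subseteq> A \<times> A" "A \<subseteq> level W k" "(v, w) \<in> star_rel W R"
  shows "(w, v) \<in> star_rel W (R\<inverse>)"
proof -
  have R: "R \<subseteq> level W k \<times> level W k" "R\<inverse> \<subseteq> level W k \<times> level W k" using assms by blast+
  have "holds (Mem W) (All_in 3 0 (All_in 4 0 (Imp (RelF 1 3 4) (RelF 2 4 3))))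
      (\<lambda>i. [code_set W A, code_rel W R, code_rel W (R\<inverse>)] ! i)"
    using assms R by (auto simp: mem_code_small rel_code)
  then have "\<forall>x. x \<in> star_set W A \<longrightarrow> (\<forall>y. y \<in> star_set W A \<longrightarrow>
      (x, y) \<in> star_rel W R \<longrightarrow> (y, x) \<in> star_rel W (R\<inverse>))"
    unfolding transfer by (simp add: star_set_iff star_rel_iff)
  with assms star_rel_dom[of R A A] show ?thesis by blast
qed

text \<open>The section of an extended relation at a standard point is the extension of the section.\<close>

lemma star_rel_section:
  assumes "R \<subseteq> A \<times> B" "A \<subseteq> level W k" "B \<subseteq> level W k" "c \<in> B"
  shows "(v, Star W c) \<in> star_rel W R \<longleftrightarrow> v \<in> star_set W {a. (a, c) \<in> R}"
proof -
  have R: "R \<subseteq> level W k \<times> level W k" and S: "{a. (a, c) \<in> R} \<subseteq> level W k"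
    using assms by blast+
  have "holds (Mem W) (All_in 4 0 (Iff (RelF 1 4 2) (Elem 4 3)))
      (\<lambda>i. [code_set W A, code_rel W R, c, code_set W {a. (a, c) \<in> R}] ! i)"
    using assms S R by (auto simp: mem_code_small rel_code)
  then have "\<forall>x. x \<in> star_set W A \<longrightarrow>
      ((x, Star W c) \<in> star_rel W R \<longleftrightarrow> x \<in> star_set W {a. (a, c) \<in> R})"
    unfolding transfer by (simp add: star_set_iff star_rel_iff)
  moreover have "star_set W {a. (a, c) \<in> R} \<subseteq> star_set W A"
    using assms by (intro star_set_mono level_k_subset) auto
  ultimately show ?thesis using star_rel_dom[OF assms(1-3)] by blast
qed

section \<open>The hypernatural numbers\<close>

abbreviation nats :: "'u set" where "nats \<equiv> range (num W)"

text \<open>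
  The order, the strict order and the successor relation on the codes of the natural numbers.
\<close>

definition nat_le :: "('u \<times> 'u) set" where "nat_le = {(num W m, num W n) | m n. m \<le> n}"
definition nat_less :: "('u \<times> 'u) set" where "nat_less = {(num W m, num W n) | m n. m < n}"
definition nat_succ :: "('u \<times> 'u) set" where "nat_succ = {(num W m, num W (Suc m)) | m. True}"

lemma nat_rels_subset: "nat_le \<subseteq> nats \<times> nats" "nat_less \<subseteq> nats \<times> nats" "nat_succ \<subseteq> nats \<times> nats"
  by (auto simp: nat_le_def nat_less_def nat_succ_def)

lemma nat_rels_small:
  "nat_le \<subseteq> level W k \<times> level W k" "nat_less \<subseteq> level W k \<times> level W k"
  "nat_succ \<subseteq> level W k \<times> level W k"
  using nat_rels_subset num_level by blast+

lemma num_rels [simp]: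
  "(num W m, num W n) \<in> nat_le \<longleftrightarrow> m \<le> n"
  "(num W m, num W n) \<in> nat_less \<longleftrightarrow> m < n"
  "(num W m, num W n) \<in> nat_succ \<longleftrightarrow> n = Suc m"
  by (auto simp: nat_le_def nat_less_def nat_succ_def)

lemma hypernat_iff: "v \<in> hypernat W \<longleftrightarrow> NMem W v (Star W (code_set W nats))"
  by (simp add: hypernat_def star_set_iff)

lemma hypernat_rel_eq:
  "hypernat_le W = star_rel W nat_le" "hypernat_less W = star_rel W nat_less"
  "hypernat_succ W = star_rel W nat_succ"
  by (simp_all only: hypernat_le_def hypernat_less_def hypernat_succ_def
      nat_le_def nat_less_def nat_succ_def)

lemma hypernat_rel_iff:
  "(v, w) \<in> hypernat_le W \<longleftrightarrow> rel (NMem W) (Star W (code_rel W nat_le)) v w"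
  "(v, w) \<in> hypernat_less W \<longleftrightarrow> rel (NMem W) (Star W (code_rel W nat_less)) v w"
  "(v, w) \<in> hypernat_succ W \<longleftrightarrow> rel (NMem W) (Star W (code_rel W nat_succ)) v w"
  by (simp_all only: hypernat_rel_eq star_rel_iff)

lemma mem_nats: "Mem W x (code_set W nats) \<longleftrightarrow> x \<in> nats"
  by (simp add: mem_code_small num_level)

lemma rel_nats:
  "rel (Mem W) (code_rel W nat_le) x y \<longleftrightarrow> (x, y) \<in> nat_le"
  "rel (Mem W) (code_rel W nat_less) x y \<longleftrightarrow> (x, y) \<in> nat_less"
  "rel (Mem W) (code_rel W nat_succ) x y \<longleftrightarrow> (x, y) \<in> nat_succ"
  by (simp_all add: rel_code nat_rels_small)

lemma hypernat_rel_dom: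
  "(v, w) \<in> hypernat_le W \<Longrightarrow> v \<in> hypernat W \<and> w \<in> hypernat W"
  "(v, w) \<in> hypernat_less W \<Longrightarrow> v \<in> hypernat W \<and> w \<in> hypernat W"
  "(v, w) \<in> hypernat_succ W \<Longrightarrow> v \<in> hypernat W \<and> w \<in> hypernat W"
proof -
  have "star_rel W R \<subseteq> hypernat W \<times> hypernat W" if "R \<subseteq> nats \<times> nats" for R
    unfolding hypernat_def using that num_level num_level by (rule star_rel_dom)
  then have "star_rel W nat_le \<subseteq> hypernat W \<times> hypernat W"
    "star_rel W nat_less \<subseteq> hypernat W \<times> hypernat W"
    "star_rel W nat_succ \<subseteq> hypernat W \<times> hypernat W"
    using nat_rels_subset by metis+
  then show
    "(v, w) \<in> hypernat_le W \<Longrightarrow> v \<in> hypernat W \<and> w \<in> hypernat W"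
    "(v, w) \<in> hypernat_less W \<Longrightarrow> v \<in> hypernat W \<and> w \<in> hypernat W"
    "(v, w) \<in> hypernat_succ W \<Longrightarrow> v \<in> hypernat W \<and> w \<in> hypernat W"
    unfolding hypernat_rel_eq by (metis SigmaE2 subsetD)+
qed

lemma Star_num_hypernat: "Star W (num W n) \<in> hypernat W"
  by (simp add: hypernat_def Star_in_star_set num_level)

lemma hypernat_le_Star: "(Star W (num W m), Star W (num W n)) \<in> hypernat_le W \<longleftrightarrow> m \<le> n"
  using star_rel_Star[OF nat_rels_small(1)] by (simp add: hypernat_rel_iff star_rel_iff)

lemma hypernat_le_trans:
  assumes "(u, v) \<in> hypernat_le W" "(v, w) \<in> hypernat_le W"
  shows "(u, w) \<in> hypernat_le W"
proof -
  have "holds (Mem W) (All_in 2 0 (All_in 3 0 (All_in 4 0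
      (Imp (RelF 1 2 3) (Imp (RelF 1 3 4) (RelF 1 2 4)))))) (\<lambda>i. [code_set W nats, code_rel W nat_le] ! i)"
    by (auto simp: mem_nats rel_nats)
  then show ?thesis
    unfolding transfer using assms assms[THEN hypernat_rel_dom(1)]
    by (simp add: hypernat_iff hypernat_rel_iff) blast
qed

lemma hypernat_le_linear:
  assumes "v \<in> hypernat W" "w \<in> hypernat W"
  shows "(v, w) \<in> hypernat_le W \<or> (w, v) \<in> hypernat_le W"
proof -
  have "holds (Mem W) (All_in 2 0 (All_in 3 0 (Disj (RelF 1 2 3) (RelF 1 3 2))))
      (\<lambda>i. [code_set W nats, code_rel W nat_le] ! i)"
    by (auto simp: mem_nats rel_nats)
  then show ?thesis
    unfolding transfer using assms by (simp add: hypernat_iff hypernat_rel_iff)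
qed

lemma hypernat_zero_le:
  assumes "n \<in> hypernat W"
  shows "(Star W (num W 0), n) \<in> hypernat_le W"
proof -
  have "holds (Mem W) (All_in 3 0 (RelF 1 2 3)) (\<lambda>i. [code_set W nats, code_rel W nat_le, num W 0] ! i)"
    by (auto simp: mem_nats rel_nats)
  then show ?thesis
    unfolding transfer using assms by (simp add: hypernat_iff hypernat_rel_iff)
qed

lemma hypernat_less_succ_le:
  assumes "(i, n) \<in> hypernat_less W" "(i, j) \<in> hypernat_succ W"
  shows "(i, n) \<in> hypernat_le W" "(j, n) \<in> hypernat_le W"
proof -
  have "holds (Mem W) (All_in 4 0 (All_in 5 0 (All_in 6 0
      (Imp (RelF 2 4 6) (Imp (RelF 3 4 5) (Conj (RelF 1 4 6) (RelF 1 5 6)))))))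
      (\<lambda>i. [code_set W nats, code_rel W nat_le, code_rel W nat_less, code_rel W nat_succ] ! i)"
    by (auto simp: mem_nats rel_nats)
  then show "(i, n) \<in> hypernat_le W" "(j, n) \<in> hypernat_le W"
    unfolding transfer using assms assms(1)[THEN hypernat_rel_dom(2)] assms(2)[THEN hypernat_rel_dom(3)]
    by (simp_all add: hypernat_iff hypernat_rel_iff) blast+
qed

text \<open>
  The nonstandard elements of \<open>hypernat W\<close> are those above every standard number: below \<open>n\<close> there
  are finitely many numbers, and a finite set acquires no new elements under extension.
\<close>

lemma infinite_hypernat_iff:
  "w \<in> infinite_hypernat W \<longleftrightarrow>
     w \<in> hypernat W \<and> (\<forall>n. (Star W (num W n), w) \<in> hypernat_le W)"
proof
  assume w: "w \<in> infinite_hypernat W"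
  have "(Star W (num W n), w) \<in> hypernat_le W" for n
  proof -
    have "(Star W (num W n), w) \<notin> hypernat_le W \<longrightarrow> w \<in> star_set W (num W ` {..<n})"
    proof -
      have "num W ` {..<n} \<subseteq> level W k" using num_level by blast
      then have "holds (Mem W) (All_in 4 0 (Imp (Neg (RelF 1 2 4)) (Elem 4 3)))
          (\<lambda>i. [code_set W nats, code_rel W nat_le, num W n, code_set W (num W ` {..<n})] ! i)"
        by (auto simp: mem_nats rel_nats mem_code_small)
      then show ?thesis
        unfolding transfer using w
        by (simp add: hypernat_iff hypernat_rel_iff star_set_iff infinite_hypernat_def)
    qed
    moreover have "w \<notin> star_set W (num W ` {..<n})"
    proof
      assume "w \<in> star_set W (num W ` {..<n})"
      then have "\<exists>i\<in>{..<n}. w \<in> star_set W {num W i}"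
        using num_level by (intro star_set_finite_UN) auto
      then show False
        using star_set_singleton num_level w by (fastforce simp: infinite_hypernat_def)
    qed
    ultimately show ?thesis by blast
  qed
  with w show "w \<in> hypernat W \<and> (\<forall>n. (Star W (num W n), w) \<in> hypernat_le W)"
    by (auto simp: infinite_hypernat_def)
next
  assume w: "w \<in> hypernat W \<and> (\<forall>n. (Star W (num W n), w) \<in> hypernat_le W)"
  have "w \<noteq> Star W (num W m)" for m
    using w hypernat_le_Star[of "Suc m" m] by auto
  with w show "w \<in> infinite_hypernat W" by (auto simp: infinite_hypernat_def)
qed

lemma infinite_hypernat_mono:
  "w \<in> infinite_hypernat W \<Longrightarrow> (w, j) \<in> hypernat_le W \<Longrightarrow> j \<in> infinite_hypernat W"
  unfolding infinite_hypernat_iff using hypernat_le_trans hypernat_rel_dom(1) by blast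

end

section \<open>Functions and paths\<close>

text \<open>
  \<open>h\<close> is a path, indexed by the numbers up to \<open>l\<close>, that runs from \<open>F p a\<close> to \<open>F p b\<close>; all its
  values are values \<open>F p i'\<close> with \<open>i' \<ge> a\<close>, and consecutive values of \<open>h\<close> are consecutive values
  of \<open>F p\<close>.  The relations \<open>L\<close>, \<open>T\<close> and \<open>S\<close> are the order, the strict order and the successor
  relation of \<open>N\<close>, and \<open>Z\<close> is its zero.
\<close>

definition segment_path ::
    "('a \<Rightarrow> 'a \<Rightarrow> bool) \<Rightarrow> 'a \<Rightarrow> 'a \<Rightarrow> 'a \<Rightarrow> 'a \<Rightarrow> 'a \<Rightarrow> 'a \<Rightarrow> 'a \<Rightarrow> 'a \<Rightarrow> 'a \<Rightarrow> 'a \<Rightarrow> 'a \<Rightarrow> 'a \<Rightarrow> bool" where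
  "segment_path E N X L T S Z F p a b h l \<longleftrightarrow>
     path_graph E N X L h l \<and>
     (\<forall>x. E x X \<longrightarrow> rel3 E F p a x \<longrightarrow> rel E h Z x) \<and>
     (\<forall>x. E x X \<longrightarrow> rel3 E F p b x \<longrightarrow> rel E h l x) \<and>
     (\<forall>i. E i N \<longrightarrow> (\<forall>x. E x X \<longrightarrow> rel E h i x \<longrightarrow>
        (\<exists>i'. E i' N \<and> rel E L a i' \<and> rel3 E F p i' x))) \<and>
     (\<forall>i. E i N \<longrightarrow> (\<forall>j. E j N \<longrightarrow> (\<forall>x. E x X \<longrightarrow> (\<forall>y. E y X \<longrightarrow>
        rel E T i l \<longrightarrow> rel E S i j \<longrightarrow> rel E h i x \<longrightarrow> rel E h j y \<longrightarrow>
        (\<exists>i'. E i' N \<and> (\<exists>j'. E j' N \<and>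
           rel E L a i' \<and> rel E S i' j' \<and> rel3 E F p i' x \<and> rel3 E F p j' y))))))"

definition SegmentF ::
    "nat \<Rightarrow> nat \<Rightarrow> nat \<Rightarrow> nat \<Rightarrow> nat \<Rightarrow> nat \<Rightarrow> nat \<Rightarrow> nat \<Rightarrow> nat \<Rightarrow> nat \<Rightarrow> nat \<Rightarrow> nat \<Rightarrow> bounded_formula" where
  "SegmentF N X L T S Z F p a b h l =
     (let i = Suc (N + X + L + T + S + Z + F + p + a + b + h + l);
          j = Suc i; x = Suc j; y = Suc x; i' = Suc y; j' = Suc i' in
      Conj (PathF N X L h l)
     (Conj (All_in x X (Imp (Rel3F F p a x) (RelF h Z x)))
     (Conj (All_in x X (Imp (Rel3F F p b x) (RelF h l x)))
     (Conj (All_in i N (All_in x X (Imp (RelF h i x)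
              (Ex_in i' N (Conj (RelF L a i') (Rel3F F p i' x))))))
           (All_in i N (All_in j N (All_in x X (All_in y X
              (Imp (RelF T i l) (Imp (RelF S i j) (Imp (RelF h i x) (Imp (RelF h j y)
                (Ex_in i' N (Ex_in j' N (Conj (RelF L a i') (Conj (RelF S i' j')
                   (Conj (Rel3F F p i' x) (Rel3F F p j' y))))))))))))))))))"

lemma holds_SegmentF [simp]:
  "holds E (SegmentF N X L T S Z F p a b h l) e \<longleftrightarrow>
     segment_path E (e N) (e X) (e L) (e T) (e S) (e Z) (e F) (e p) (e a) (e b) (e h) (e l)"
  by (simp add: SegmentF_def segment_path_def Let_def)

text \<open>
  \<open>h\<close> runs through the path \<open>f\<close> up to its index \<open>n\<close> and then backwards through the path \<open>g\<close>, from
  its index \<open>m\<close>.  Two consecutive values of \<open>h\<close> are the two ends \<open>f n\<close> and \<open>g m\<close>, or they are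
  consecutive in \<open>f\<close>, or in \<open>g\<close> in the opposite order.  Stated like this, the relation between
  the indices of the three paths is not needed, and addition does not occur.
\<close>

definition join_path ::
    "('a \<Rightarrow> 'a \<Rightarrow> bool) \<Rightarrow> 'a \<Rightarrow> 'a \<Rightarrow> 'a \<Rightarrow> 'a \<Rightarrow> 'a \<Rightarrow> 'a \<Rightarrow> 'a \<Rightarrow> 'a \<Rightarrow> 'a \<Rightarrow> 'a \<Rightarrow> 'a \<Rightarrow> 'a \<Rightarrow> bool" where
  "join_path E N X L T S Z f n g m h l \<longleftrightarrow>
     path_graph E N X L h l \<and>
     (\<forall>x. E x X \<longrightarrow> rel E f Z x \<longrightarrow> rel E h Z x) \<and>
     (\<forall>x. E x X \<longrightarrow> rel E g Z x \<longrightarrow> rel E h l x) \<and>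
     (\<forall>i. E i N \<longrightarrow> (\<forall>x. E x X \<longrightarrow> rel E h i x \<longrightarrow>
        (\<exists>i'. E i' N \<and> (rel E f i' x \<or> rel E g i' x)))) \<and>
     (\<forall>i. E i N \<longrightarrow> (\<forall>j. E j N \<longrightarrow> (\<forall>x. E x X \<longrightarrow> (\<forall>y. E y X \<longrightarrow>
        rel E T i l \<longrightarrow> rel E S i j \<longrightarrow> rel E h i x \<longrightarrow> rel E h j y \<longrightarrow>
        rel E f n x \<and> rel E g m y \<or>
        (\<exists>i'. E i' N \<and> (\<exists>j'. E j' N \<and> rel E S i' j' \<and>
           (rel E T i' n \<and> rel E f i' x \<and> rel E f j' y \<or>
            rel E T i' m \<and> rel E g i' y \<and> rel E g j' x)))))))"

definition JoinF ::
    "nat \<Rightarrow> nat \<Rightarrow> nat \<Rightarrow> nat \<Rightarrow> nat \<Rightarrow> nat \<Rightarrow> nat \<Rightarrow> nat \<Rightarrow> nat \<Rightarrow> nat \<Rightarrow> nat \<Rightarrow> nat \<Rightarrow> bounded_formula" where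
  "JoinF N X L T S Z f n g m h l =
     (let i = Suc (N + X + L + T + S + Z + f + n + g + m + h + l);
          j = Suc i; x = Suc j; y = Suc x; i' = Suc y; j' = Suc i' in
      Conj (PathF N X L h l)
     (Conj (All_in x X (Imp (RelF f Z x) (RelF h Z x)))
     (Conj (All_in x X (Imp (RelF g Z x) (RelF h l x)))
     (Conj (All_in i N (All_in x X (Imp (RelF h i x)
              (Ex_in i' N (Disj (RelF f i' x) (RelF g i' x))))))
           (All_in i N (All_in j N (All_in x X (All_in y X
              (Imp (RelF T i l) (Imp (RelF S i j) (Imp (RelF h i x) (Imp (RelF h j y)
                (Disj (Conj (RelF f n x) (RelF g m y))
                (Ex_in i' N (Ex_in j' N (Conj (RelF S i' j')
                   (Disj (Conj (RelF T i' n) (Conj (RelF f i' x) (RelF f j' y)))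
                         (Conj (RelF T i' m) (Conj (RelF g i' y) (RelF g j' x))))))))))))))))))))"

lemma holds_JoinF [simp]:
  "holds E (JoinF N X L T S Z f n g m h l) e \<longleftrightarrow>
     join_path E (e N) (e X) (e L) (e T) (e S) (e Z) (e f) (e n) (e g) (e m) (e h) (e l)"
  by (simp add: JoinF_def join_path_def Let_def)

text \<open>
  A metric space whose points lie in level \<open>k\<close>, with base point \<open>\<xi>\<close>.
\<close>

locale coded_metric_space = coded_universe W k + Metric_space M d
  for W :: "('u, 'v) universe" and k and M :: "'u set" and d +
  fixes \<xi> :: 'u
  assumes M_level: "M \<subseteq> level W k" and base_point: "\<xi> \<in> M"
begin

abbreviation "nats_c \<equiv> code_set W nats"
abbreviation "M_c \<equiv> code_set W M"
abbreviation "le_c \<equiv> code_rel W nat_le"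
abbreviation "less_c \<equiv> code_rel W nat_less"
abbreviation "succ_c \<equiv> code_rel W nat_succ"

lemma mem_M: "Mem W x M_c \<longleftrightarrow> x \<in> M"
  by (simp add: mem_code_small M_level)

lemma star_M_iff: "v \<in> star_set W M \<longleftrightarrow> NMem W v (Star W M_c)"
  by (simp add: star_set_iff)

lemma subset_M_small: "A \<subseteq> M \<Longrightarrow> A \<subseteq> level W k"
  using M_level by blast

lemma rel_M_small: "R \<subseteq> M \<times> M \<Longrightarrow> R \<subseteq> level W k \<times> level W k"
  using M_level by blast

subsection \<open>Sequences and families of sequences\<close>

definition graph :: "(nat \<Rightarrow> 'u) \<Rightarrow> ('u \<times> 'u) set" where
  "graph s = {(num W n, s n) | n. True}"

lemma graph_iff [simp]: "(num W n, x) \<in> graph s \<longleftrightarrow> x = s n"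
  by (auto simp: graph_def)

lemma rel_graph:
  assumes "range s \<subseteq> level W k"
  shows "rel (Mem W) (code_rel W (graph s)) x y \<longleftrightarrow> (x, y) \<in> graph s"
  using assms num_level by (intro rel_code) (auto simp: graph_def)

lemma star_seq:
  assumes s: "range s \<subseteq> B" and B: "B \<subseteq> level W k" and w: "w \<in> hypernat W"
  shows "star_seq W s w \<in> star_set W B" "(w, x) \<in> star_rel W (graph s) \<longleftrightarrow> x = star_seq W s w"
proof -
  have sk: "range s \<subseteq> level W k" using s B by blast
  have "holds (Mem W) (All_in 3 0 (Ex_in 4 1 (RelF 2 3 4)))
      (\<lambda>i. [nats_c, code_set W B, code_rel W (graph s)] ! i)"
    using s B sk by (auto simp: mem_nats mem_code_small rel_graph)
  then obtain u where u: "u \<in> star_set W B" "(w, u) \<in> star_rel W (graph s)"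
    unfolding transfer using w by (auto simp: hypernat_iff star_set_iff star_rel_iff)
  have "holds (Mem W) (All_in 3 0 (All_in 4 1 (All_in 5 1 (Imp (RelF 2 3 4) (Imp (RelF 2 3 5) (Equal 4 5))))))
      (\<lambda>i. [nats_c, code_set W B, code_rel W (graph s)] ! i)"
    using s B sk by (auto simp: mem_nats mem_code_small rel_graph)
  then have uniq: "y = z" if "(w, y) \<in> star_rel W (graph s)" "(w, z) \<in> star_rel W (graph s)"
      "y \<in> star_set W B" "z \<in> star_set W B" for y z
    unfolding transfer using w that by (simp add: hypernat_iff star_set_iff star_rel_iff)
  have "star_rel W (graph s) \<subseteq> star_set W nats \<times> star_set W B"
    using s B num_level by (intro star_rel_dom) (auto simp: graph_def)
  then have "(w, x) \<in> star_rel W (graph s) \<longleftrightarrow> x = u" for x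
    using u uniq by blast
  then have "star_seq W s w = u" and *: "(w, x) \<in> star_rel W (graph s) \<longleftrightarrow> x = u" for x
    by (simp_all add: star_seq_def graph_def)
  with u show "star_seq W s w \<in> star_set W B"
    and "(w, x) \<in> star_rel W (graph s) \<longleftrightarrow> x = star_seq W s w"
    by simp_all
qed

text \<open>
  The graph of a family of sequences that is indexed by the points of \<open>M\<close>.
\<close>

definition graph3 :: "('u \<Rightarrow> nat \<Rightarrow> 'u) \<Rightarrow> ('u \<times> 'u \<times> 'u) set" where
  "graph3 F = {(y, num W i, F y i) | y i. y \<in> M}"

text \<open>
  \<open>star_fun F y i v\<close> says that the extension of \<open>F\<close> takes the value \<open>v\<close> at the point \<open>y\<close> of
  the extension of \<open>M\<close> and the hypernatural \<open>i\<close>.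
\<close>

definition star_fun :: "('u \<Rightarrow> nat \<Rightarrow> 'u) \<Rightarrow> 'v \<Rightarrow> 'v \<Rightarrow> 'v \<Rightarrow> bool" where
  "star_fun F = rel3 (NMem W) (Star W (code_rel3 (graph3 F)))"

lemma rel3_graph3:
  assumes "\<And>y i. y \<in> M \<Longrightarrow> F y i \<in> M"
  shows "rel3 (Mem W) (code_rel3 (graph3 F)) y a z \<longleftrightarrow> y \<in> M \<and> (\<exists>i. a = num W i \<and> z = F y i)"
proof -
  have "graph3 F \<subseteq> level W k \<times> level W k \<times> level W k"
    using assms M_level num_level by (auto simp: graph3_def)
  then show ?thesis by (auto simp: rel3_code graph3_def)
qed

lemma star_fun_total:
  assumes F: "\<And>y i. y \<in> M \<Longrightarrow> F y i \<in> M" and "x \<in> star_set W M" "w \<in> hypernat W"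
  shows "\<exists>v\<in>star_set W M. star_fun F x w v"
proof -
  have "holds (Mem W) (All_in 3 1 (All_in 4 0 (Ex_in 5 1 (Rel3F 2 3 4 5))))
      (\<lambda>i. [nats_c, M_c, code_rel3 (graph3 F)] ! i)"
    using F by (auto simp: mem_nats mem_M rel3_graph3)
  then show ?thesis
    unfolding transfer using assms by (simp add: Bex_def hypernat_iff star_set_iff star_fun_def)
qed

lemma star_fun_values:
  assumes F: "\<And>y i. y \<in> M \<Longrightarrow> F y i \<in> M"
    and AB: "A \<subseteq> M" "B \<subseteq> M" "\<And>y j. y \<in> A \<Longrightarrow> K \<le> j \<Longrightarrow> F y j \<in> B"
    and x: "x \<in> star_set W A" "(Star W (num W K), j) \<in> hypernat_le W"
    and v: "star_fun F x j v" "v \<in> star_set W M"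
  shows "v \<in> star_set W B"
proof -
  have "holds (Mem W) (All_in 7 2 (All_in 8 0 (All_in 9 1
      (Imp (RelF 4 6 8) (Imp (Rel3F 5 7 8 9) (Elem 9 3))))))
      (\<lambda>i. [nats_c, M_c, code_set W A, code_set W B, le_c, code_rel3 (graph3 F), num W K] ! i)"
    using F AB subset_M_small
    by (auto simp: mem_nats mem_M rel3_graph3 mem_code_small rel_nats)
  then show ?thesis
    unfolding transfer using x v hypernat_rel_dom(1)[OF x(2)]
    by (simp add: hypernat_iff star_set_iff star_fun_def hypernat_rel_iff) blast
qed

lemma star_fun_steps:
  assumes F: "\<And>y i. y \<in> M \<Longrightarrow> F y i \<in> M"
    and R: "R \<subseteq> M \<times> M" "\<And>y j. y \<in> M \<Longrightarrow> (F y j, F y (Suc j)) \<in> R"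
    and x: "x \<in> star_set W M" "(i, j) \<in> hypernat_succ W"
    and uv: "star_fun F x i u" "u \<in> star_set W M" "star_fun F x j v" "v \<in> star_set W M"
  shows "(u, v) \<in> star_rel W R"
proof -
  have "holds (Mem W) (All_in 5 1 (All_in 6 0 (All_in 7 0 (All_in 8 1 (All_in 9 1
      (Imp (RelF 4 6 7) (Imp (Rel3F 2 5 6 8) (Imp (Rel3F 2 5 7 9) (RelF 3 8 9)))))))))
      (\<lambda>i. [nats_c, M_c, code_rel3 (graph3 F), code_rel W R, succ_c] ! i)"
    using F R rel_M_small
    by (auto simp: mem_nats mem_M rel3_graph3 rel_code rel_nats)
  then show ?thesis
    unfolding transfer using x uv hypernat_rel_dom(3)[OF x(2)]
    by (simp add: hypernat_iff star_set_iff star_fun_def hypernat_rel_iff star_rel_iff) blast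
qed

text \<open>
  A single sequence is a constant family, so facts about families apply to sequences.
\<close>

lemma star_fun_star_seq:
  assumes s: "range s \<subseteq> M" and "x \<in> star_set W M" "w \<in> hypernat W"
  shows "star_fun (\<lambda>_. s) x w (star_seq W s w)"
proof -
  have "rel3 (Mem W) (code_rel3 (graph3 (\<lambda>_. s))) y a z \<longleftrightarrow> y \<in> M \<and> (\<exists>i. a = num W i \<and> z = s i)"
    for y a z
    using s by (intro rel3_graph3) auto
  then have "holds (Mem W) (All_in 4 1 (All_in 5 0 (All_in 6 1 (Imp (RelF 3 5 6) (Rel3F 2 4 5 6)))))
      (\<lambda>i. [nats_c, M_c, code_rel3 (graph3 (\<lambda>_. s)), code_rel W (graph s)] ! i)"
    using s by (auto simp: mem_nats mem_M rel_graph subset_M_small)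
  moreover note star_seq[OF s M_level assms(3)]
  ultimately show ?thesis
    unfolding transfer using assms by (simp add: hypernat_iff star_set_iff star_fun_def star_rel_iff)
qed

subsection \<open>Finite and infinite points\<close>

text \<open>
  The controlled relation of pairs at distance at most \<open>C\<close>, and the complement of the closed ball
  of radius \<open>R\<close> about \<open>\<xi>\<close>.  Natural numbers suffice as bounds, so no hyperreals are needed.
\<close>

definition near :: "nat \<Rightarrow> ('u \<times> 'u) set" where
  "near C = {(a, b). a \<in> M \<and> b \<in> M \<and> d a b \<le> real C}"

definition far :: "nat \<Rightarrow> 'u set" where
  "far R = {a \<in> M. real R < d a \<xi>}"

lemma near_subset: "near C \<subseteq> M \<times> M" and far_subset: "far R \<subseteq> M"
  by (auto simp: near_def far_def)

lemma sim_iff: "sim W M d u v \<longleftrightarrow> (\<exists>C. (u, v) \<in> star_rel W (near C))"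
proof
  assume "sim W M d u v"
  then obtain E where E: "E \<in> bounded_coarse M d" "(u, v) \<in> star_rel W E"
    by (auto simp: sim_def)
  then obtain B where B: "\<And>x y. (x, y) \<in> E \<Longrightarrow> d x y \<le> B" "E \<subseteq> M \<times> M"
    unfolding bounded_coarse_def bdd_above_def by fast
  have "E \<subseteq> near (nat \<lceil>B\<rceil>)"
    using B by (force simp: near_def intro: order_trans[OF _ real_nat_ceiling_ge])
  then show "\<exists>C. (u, v) \<in> star_rel W (near C)"
    using E star_rel_mono rel_M_small[OF near_subset] by blast
next
  assume "\<exists>C. (u, v) \<in> star_rel W (near C)"
  moreover have "near C \<in> bounded_coarse M d" for C
    by (auto simp: bounded_coarse_def near_def bdd_above_def)
  ultimately show "sim W M d u v" by (auto simp: sim_def)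
qed

lemma near_converse: "(near C)\<inverse> = near C"
  by (auto simp: near_def commute)

lemma sim_sym: "sim W M d u v \<Longrightarrow> sim W M d v u"
  unfolding sim_iff using star_rel_converse[OF near_subset M_level] by (auto simp: near_converse)

lemma INF_iff: "v \<in> INF_pts W M d \<xi> \<longleftrightarrow> v \<in> star_set W M \<and> (\<forall>R. v \<in> star_set W (far R))"
proof -
  have *: "(v, Star W \<xi>) \<in> star_rel W (near R) \<longleftrightarrow> v \<notin> star_set W (far R)"
    if v: "v \<in> star_set W M" for R
  proof -
    let ?A = "{a. (a, \<xi>) \<in> near R}"
    have A: "?A \<subseteq> M" "M \<subseteq> ?A \<union> far R" "?A \<inter> far R = {}"
      using base_point by (auto simp: near_def far_def)
    then have "star_set W M \<subseteq> star_set W ?A \<union> star_set W (far R)"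
      by (intro star_set_Un level_k_subset subset_M_small far_subset)
    moreover have "\<not> (v \<in> star_set W ?A \<and> v \<in> star_set W (far R))"
      using star_set_Int[of ?A "far R" v] A star_set_empty subset_M_small far_subset by auto
    ultimately show ?thesis
      using star_rel_section[OF near_subset M_level M_level base_point] v by blast
  qed
  then show ?thesis
    unfolding INF_pts_def sim_iff by auto
qed

lemma INF_star_M: "v \<in> INF_pts W M d \<xi> \<Longrightarrow> v \<in> star_set W M"
  by (simp add: INF_pts_def)

subsection \<open>Internal paths\<close>

text \<open>
  The codes of all relations between the natural numbers and \<open>M\<close>.
\<close>

definition paths :: "'u set" where
  "paths = {a. a \<notin> Atoms W \<and> (\<forall>p. Mem W p a \<longrightarrow> (\<exists>i x. x \<in> M \<and> is_pair (Mem W) p (num W i) x))}"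

abbreviation "paths_c \<equiv> code_set W paths"

lemma paths_level: "paths \<subseteq> level W (k + 4)"
proof
  fix a assume a: "a \<in> paths"
  have "a \<in> level W (Suc (k + 2))"
  proof (rule level_SucI)
    show "a \<notin> Atoms W" using a by (simp add: paths_def)
    fix p assume "Mem W p a"
    then obtain i x where "x \<in> M" "is_pair (Mem W) p (num W i) x"
      using a by (auto simp: paths_def)
    then show "p \<in> level W (k + 2)"
      using pair_level M_level num_level by blast
  qed
  then show "a \<in> level W (k + 4)"
    using level_mono[of "Suc (k + 2)" "k + 4" W] by auto
qed

lemma mem_paths:
  "Mem W a paths_c \<longleftrightarrow> a \<notin> Atoms W \<and>
     (\<forall>p. Mem W p a \<longrightarrow> (\<exists>i x. x \<in> M \<and> is_pair (Mem W) p (num W i) x))"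
  unfolding mem_code[OF paths_level] by (simp add: paths_def)

abbreviation "std_path \<equiv> path_graph (Mem W) nats_c M_c le_c"
abbreviation "star_path \<equiv> path_graph (NMem W) (Star W nats_c) (Star W M_c) (Star W le_c)"

text \<open>
  A standard path is an ordinary finite sequence \<open>u\<close>.
\<close>

lemma std_pathE:
  assumes "std_path f (num W n)"
  obtains u where "\<And>i. i \<le> n \<Longrightarrow> u i \<in> M"
    "\<And>i x. x \<in> M \<Longrightarrow> rel (Mem W) f (num W i) x \<longleftrightarrow> i \<le> n \<and> x = u i"
proof -
  have 1: "i \<le> n \<longleftrightarrow> (\<exists>x. x \<in> M \<and> rel (Mem W) f (num W i) x)" for i
    using assms num_rels(1)[of i n] unfolding path_graph_def mem_nats mem_M rel_nats by blast
  have 2: "x = y" if "x \<in> M" "y \<in> M" "rel (Mem W) f (num W i) x" "rel (Mem W) f (num W i) y" for i x y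
    using assms that unfolding path_graph_def mem_nats mem_M by blast
  obtain u where "\<And>i. i \<le> n \<Longrightarrow> u i \<in> M \<and> rel (Mem W) f (num W i) (u i)"
    using 1 by metis
  then show thesis using that[of u] 1 2 by metis
qed

lemma std_pathI:
  assumes "\<And>i. i \<le> n \<Longrightarrow> u i \<in> M"
  obtains f where "Mem W f paths_c" "std_path f (num W n)"
    "\<And>i x. rel (Mem W) f (num W i) x \<longleftrightarrow> i \<le> n \<and> x = u i"
proof -
  define R where "R = {(num W i, u i) | i. i \<le> n}"
  have R: "R \<subseteq> level W k \<times> level W k"
    using assms M_level num_level by (auto simp: R_def)
  have rel: "rel (Mem W) (code_rel W R) (num W i) x \<longleftrightarrow> i \<le> n \<and> x = u i" for i x
    using rel_code[OF R] by (auto simp: R_def)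
  have mem: "Mem W p (code_rel W R) \<longleftrightarrow> (\<exists>i. i \<le> n \<and> is_pair (Mem W) p (num W i) (u i))" for p
    using code_rel(2)[OF R] by (auto simp: R_def)
  have "Mem W (code_rel W R) paths_c"
    unfolding mem_paths using code_rel(1)[OF R] mem assms by auto
  moreover have "std_path (code_rel W R) (num W n)"
    unfolding path_graph_def using assms mem by (auto simp: mem_nats mem_M rel_nats rel)
  ultimately show thesis using that rel by blast
qed

text \<open>
  The internal path \<open>f\<close> with index set \<open>{i. i \<le> n}\<close> witnesses that \<open>x\<close> and \<open>y\<close> are equivalent
  under \<open>iota_rel\<close>.
\<close>

definition connects :: "'v \<Rightarrow> 'v \<Rightarrow> 'v \<Rightarrow> 'v \<Rightarrow> bool" where
  "connects f n x y \<longleftrightarrow>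
     NMem W f (Star W paths_c) \<and> n \<in> hypernat W \<and> star_path f n \<and>
     rel (NMem W) f (Star W (num W 0)) x \<and> rel (NMem W) f n y \<and>
     (\<forall>i v. rel (NMem W) f i v \<longrightarrow> v \<in> INF_pts W M d \<xi>) \<and>
     (\<forall>i j u v. (i, n) \<in> hypernat_less W \<longrightarrow> (i, j) \<in> hypernat_succ W \<longrightarrow>
        rel (NMem W) f i u \<longrightarrow> rel (NMem W) f j v \<longrightarrow> sim W M d u v)"

lemma star_pathD:
  assumes "star_path f n"
  shows "NMem W p f \<Longrightarrow> \<exists>i v. i \<in> hypernat W \<and> v \<in> star_set W M \<and> is_pair (NMem W) p i v"
    and "i \<in> hypernat W \<Longrightarrow>
      (i, n) \<in> hypernat_le W \<longleftrightarrow> (\<exists>v. v \<in> star_set W M \<and> rel (NMem W) f i v)"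
    and "\<lbrakk>i \<in> hypernat W; u \<in> star_set W M; v \<in> star_set W M;
      rel (NMem W) f i u; rel (NMem W) f i v\<rbrakk> \<Longrightarrow> u = v"
  using assms unfolding path_graph_def hypernat_iff star_M_iff hypernat_rel_iff by metis+

lemma star_path_dom:
  assumes "star_path f n" "rel (NMem W) f i v"
  shows "i \<in> hypernat W" "v \<in> star_set W M"
proof -
  obtain p where p: "NMem W p f" "is_pair (NMem W) p i v"
    using assms by (auto simp: rel_def)
  then obtain i' v' where "i' \<in> hypernat W" "v' \<in> star_set W M" "is_pair (NMem W) p i' v'"
    using star_pathD(1)[OF assms(1)] by metis
  with p is_pair_inject show "i \<in> hypernat W" "v \<in> star_set W M"
    by metis+
qed

lemma star_path_unique:
  "star_path f n \<Longrightarrow> rel (NMem W) f i u \<Longrightarrow> rel (NMem W) f i v \<Longrightarrow> u = v"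
  using star_path_dom[of f n i u] star_path_dom[of f n i v] star_pathD(3)[of f n i u v] by blast

lemma star_path_le:
  assumes "star_path f n" "i \<in> hypernat W"
  shows "(i, n) \<in> hypernat_le W \<longleftrightarrow> (\<exists>v. rel (NMem W) f i v)"
  using assms star_path_dom[of f n i] star_pathD(2)[of f n i] by blast

text \<open>
  An internal set of pairs belongs to the extension of the set of all relations between the
  natural numbers and \<open>M\<close>, and this set bounds the quantifiers over paths.  Nonemptiness excludes
  atoms, which have no members either.
\<close>

lemma internal_paths:
  assumes "internal W f" "NMem W q f"
    and pairs: "\<And>p. NMem W p f \<Longrightarrow>
      \<exists>i x. i \<in> hypernat W \<and> x \<in> star_set W M \<and> is_pair (NMem W) p i x"
  shows "NMem W f (Star W paths_c)"
proof -
  obtain A where A: "NMem W f (Star W A)"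
    using assms(1) by (auto simp: internal_def)
  have "holds (Mem W) (All_in 4 0 (Imp (Ex_in 5 4 (Equal 5 5))
      (Imp (All_in 5 4 (Ex_in 6 1 (Ex_in 7 2 (PairF 5 6 7)))) (Elem 4 3))))
      (\<lambda>i. [A, nats_c, M_c, paths_c] ! i)"
    using not_atom by (auto simp: mem_nats mem_M mem_paths)
  then have "\<forall>g. NMem W g (Star W A) \<longrightarrow> (\<exists>q. NMem W q g) \<longrightarrow> (\<forall>p. NMem W p g \<longrightarrow>
      (\<exists>i. i \<in> hypernat W \<and> (\<exists>x. x \<in> star_set W M \<and> is_pair (NMem W) p i x))) \<longrightarrow>
      NMem W g (Star W paths_c)"
    unfolding transfer by (simp add: hypernat_iff star_M_iff)
  with A assms(2) pairs show ?thesis by blast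
qed

lemma iota_rel_iff:
  "(x, y) \<in> iota_rel W M d \<xi> \<longleftrightarrow> (\<exists>f n. connects f n x y)"
proof
  assume "(x, y) \<in> iota_rel W M d \<xi>"
  then obtain n t where n: "n \<in> hypernat W" and t: "internal_sequence W n t"
    and INF: "\<And>i. i \<in> hypernat W \<Longrightarrow> (i, n) \<in> hypernat_le W \<Longrightarrow> t i \<in> INF_pts W M d \<xi>"
    and ends: "t (Star W (num W 0)) = x" "t n = y"
    and steps: "\<And>i j. (i, n) \<in> hypernat_less W \<Longrightarrow> (i, j) \<in> hypernat_succ W \<Longrightarrow> sim W M d (t i) (t j)"
    unfolding iota_rel_def by auto
  obtain f where f: "internal W f" "\<And>p. NMem W p f \<Longrightarrow> \<exists>i x. is_pair (NMem W) p i x"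
    and eq: "{(i, x). \<exists>p. NMem W p f \<and> is_pair (NMem W) p i x} =
        {(i, t i) | i. i \<in> hypernat W \<and> (i, n) \<in> hypernat_le W}"
    using t unfolding internal_sequence_def by blast
  have rel: "rel (NMem W) f i v \<longleftrightarrow> i \<in> hypernat W \<and> (i, n) \<in> hypernat_le W \<and> v = t i" for i v
    using eq unfolding rel_def set_eq_iff by auto
  have tM: "t i \<in> star_set W M" if "i \<in> hypernat W" "(i, n) \<in> hypernat_le W" for i
    using INF[OF that] by (rule INF_star_M)
  have pairs: "\<exists>i v. i \<in> hypernat W \<and> v \<in> star_set W M \<and> is_pair (NMem W) p i v" if "NMem W p f" for p
  proof -
    obtain i v where p: "is_pair (NMem W) p i v" using f(2) \<open>NMem W p f\<close> by blast
    then have "rel (NMem W) f i v" using that by (auto simp: rel_def)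
    then show ?thesis using p rel tM by metis
  qed
  have zero: "rel (NMem W) f (Star W (num W 0)) x"
    using rel n hypernat_zero_le Star_num_hypernat ends by auto
  then obtain q where "NMem W q f" by (auto simp: rel_def)
  then have "NMem W f (Star W paths_c)" using internal_paths[OF f(1)] pairs by metis
  moreover have "(n, n) \<in> hypernat_le W" using hypernat_le_linear[OF n n] by simp
  then have "rel (NMem W) f n y" using rel n ends by auto
  moreover have "star_path f n"
    unfolding path_graph_def hypernat_iff[symmetric] star_M_iff[symmetric] hypernat_rel_iff[symmetric]
    using pairs by (auto simp: rel tM)
  ultimately have "connects f n x y"
    unfolding connects_def using n zero INF rel steps by auto
  then show "\<exists>f n. connects f n x y" by blast
next
  assume "\<exists>f n. connects f n x y"
  then obtain f n where c: "connects f n x y" by blast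
  then have path: "star_path f n" and n: "n \<in> hypernat W"
    and INF: "\<And>i v. rel (NMem W) f i v \<Longrightarrow> v \<in> INF_pts W M d \<xi>"
    by (auto simp: connects_def)
  define t where "t i = (THE v. rel (NMem W) f i v)" for i
  have t_eq: "t i = v" if "rel (NMem W) f i v" for i v
    unfolding t_def using that star_path_unique[OF path] by blast
  have rel: "rel (NMem W) f i v \<longleftrightarrow> i \<in> hypernat W \<and> (i, n) \<in> hypernat_le W \<and> v = t i" for i v
    using t_eq star_path_le[OF path] star_path_dom[OF path] by metis
  have "internal W f" using c by (auto simp: connects_def internal_def)
  moreover have "\<exists>i v. is_pair (NMem W) p i v" if "NMem W p f" for p
    using star_pathD(1)[OF path] that by blast
  ultimately have "internal_sequence W n t"
    unfolding internal_sequence_def using rel unfolding rel_def by (intro exI[of _ f]) auto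
  moreover have "sim W M d (t i) (t j)"
    if ij: "(i, n) \<in> hypernat_less W" "(i, j) \<in> hypernat_succ W" for i j
  proof -
    have "rel (NMem W) f i (t i)" "rel (NMem W) f j (t j)"
      using hypernat_less_succ_le[OF ij] hypernat_rel_dom(2)[OF ij(1)] hypernat_rel_dom(3)[OF ij(2)]
      by (simp_all add: rel)
    then show ?thesis using c ij unfolding connects_def by metis
  qed
  moreover have "t i \<in> INF_pts W M d \<xi>" if "i \<in> hypernat W" "(i, n) \<in> hypernat_le W" for i
    using INF that by (simp add: rel)
  moreover have "t (Star W (num W 0)) = x" "t n = y" "x \<in> INF_pts W M d \<xi>" "y \<in> INF_pts W M d \<xi>"
    using c t_eq INF by (auto simp: connects_def)
  ultimately show "(x, y) \<in> iota_rel W M d \<xi>"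
    unfolding iota_rel_def using n by blast
qed

subsection \<open>Joining paths\<close>

abbreviation "std_join \<equiv> join_path (Mem W) nats_c M_c le_c less_c succ_c (num W 0)"
abbreviation "star_join \<equiv> join_path (NMem W) (Star W nats_c) (Star W M_c) (Star W le_c)
  (Star W less_c) (Star W succ_c) (Star W (num W 0))"

text \<open>
  The paths \<open>u\<close> on \<open>{..n}\<close> and \<open>v\<close> on \<open>{..m}\<close> are joined to
  \<open>u 0, \<dots>, u n, v m, \<dots>, v 0\<close>, with last index \<open>n + m + 1\<close>.
\<close>

lemma std_join:
  assumes "std_path f (num W n)" "std_path g (num W m)"
  shows "\<exists>h l. Mem W h paths_c \<and> std_join f (num W n) g (num W m) h (num W l)"
proof -
  obtain u where u: "\<And>i. i \<le> n \<Longrightarrow> u i \<in> M"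
    and f: "\<And>i x. x \<in> M \<Longrightarrow> rel (Mem W) f (num W i) x \<longleftrightarrow> i \<le> n \<and> x = u i"
    using that by (rule std_pathE[OF assms(1)])
  obtain v where v: "\<And>i. i \<le> m \<Longrightarrow> v i \<in> M"
    and g: "\<And>i x. x \<in> M \<Longrightarrow> rel (Mem W) g (num W i) x \<longleftrightarrow> i \<le> m \<and> x = v i"
    using that by (rule std_pathE[OF assms(2)])
  define t where "t i = (if i \<le> n then u i else v (n + m + 1 - i))" for i
  define l where "l = n + m + 1"
  have t_M: "t i \<in> M" if "i \<le> l" for i
    using u v that by (auto simp: t_def l_def)
  obtain h where h: "Mem W h paths_c" "std_path h (num W l)"
    "\<And>i x. rel (Mem W) h (num W i) x \<longleftrightarrow> i \<le> l \<and> x = t i"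
    using std_pathI[of l t] t_M by blast
  have vals: "\<exists>i'. rel (Mem W) f (num W i') (t i) \<or> rel (Mem W) g (num W i') (t i)" if "i \<le> l" for i
  proof (cases "i \<le> n")
    case True
    then show ?thesis using f[OF t_M[OF that], of i] by (auto simp: t_def)
  next
    case False
    then show ?thesis using g[OF t_M[OF that], of "n + m + 1 - i"] by (auto simp: t_def)
  qed
  have steps: "rel (Mem W) f (num W n) (t i) \<and> rel (Mem W) g (num W m) (t (Suc i)) \<or>
      (\<exists>i'. i' < n \<and> rel (Mem W) f (num W i') (t i) \<and> rel (Mem W) f (num W (Suc i')) (t (Suc i)) \<or>
        i' < m \<and> rel (Mem W) g (num W i') (t (Suc i)) \<and> rel (Mem W) g (num W (Suc i')) (t i))"
    if "i < l" for i
  proof -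
    have M: "t i \<in> M" "t (Suc i) \<in> M" using t_M that by auto
    consider "i < n" | "i = n" | "n < i" by linarith
    then show ?thesis
    proof cases
      case 1
      then have "rel (Mem W) f (num W i) (t i) \<and> rel (Mem W) f (num W (Suc i)) (t (Suc i))"
        by (simp add: f M) (simp add: t_def)
      with 1 show ?thesis by blast
    next
      case 2
      then show ?thesis unfolding f[OF M(1)] g[OF M(2)] by (simp add: t_def)
    next
      case 3
      have "n + m + 1 - i = Suc (n + m - i)" "n + m - i < m" using 3 that by (auto simp: l_def)
      moreover from this have "rel (Mem W) g (num W (n + m - i)) (t (Suc i)) \<and>
          rel (Mem W) g (num W (Suc (n + m - i))) (t i)"
        using 3 by (simp add: g M) (simp add: t_def)
      ultimately show ?thesis by blast
    qed
  qed
  have "std_join f (num W n) g (num W m) h (num W l)"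
    unfolding join_path_def mem_nats mem_M rel_nats
  proof (intro conjI allI impI)
    show "std_path h (num W l)" by (rule h(2))
    show "rel (Mem W) h (num W 0) x" if "x \<in> M" "rel (Mem W) f (num W 0) x" for x
      using that by (simp add: f h(3) t_def)
    show "rel (Mem W) h (num W l) x" if "x \<in> M" "rel (Mem W) g (num W 0) x" for x
      using that by (simp add: g h(3) t_def l_def)
    show "\<exists>i'. i' \<in> nats \<and> (rel (Mem W) f i' x \<or> rel (Mem W) g i' x)"
      if "i \<in> nats" "rel (Mem W) h i x" for i x
      using that vals by (auto simp: h(3))
    show "rel (Mem W) f (num W n) x \<and> rel (Mem W) g (num W m) y \<or>
        (\<exists>i'. i' \<in> nats \<and> (\<exists>j'. j' \<in> nats \<and> (i', j') \<in> nat_succ \<and>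
           ((i', num W n) \<in> nat_less \<and> rel (Mem W) f i' x \<and> rel (Mem W) f j' y \<or>
            (i', num W m) \<in> nat_less \<and> rel (Mem W) g i' y \<and> rel (Mem W) g j' x)))"
      if ij: "i \<in> nats" "j \<in> nats" "(i, num W l) \<in> nat_less" "(i, j) \<in> nat_succ"
        "rel (Mem W) h i x" "rel (Mem W) h j y" for i j x y
    proof -
      obtain a where a: "i = num W a" "a < l" "j = num W (Suc a)" "x = t a" "y = t (Suc a)"
        using ij by (auto simp: h(3))
      show ?thesis
        using steps[OF a(2)] unfolding a(4,5)
        by (metis num_rels(2,3) rangeI)
    qed
  qed
  with h(1) show ?thesis by blast
qed

lemma connects_join:
  assumes "connects f n x u" "connects g m y v" "sim W M d u v"
  shows "\<exists>h l. connects h l x y"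
proof -
  have "holds (Mem W) (All_in 7 6 (All_in 8 6 (All_in 9 0 (All_in 10 0
      (Imp (PathF 0 1 2 7 9) (Imp (PathF 0 1 2 8 10)
        (Ex_in 11 6 (Ex_in 12 0 (JoinF 0 1 2 3 4 5 7 9 8 10 11 12)))))))))
      (\<lambda>i. [nats_c, M_c, le_c, less_c, succ_c, num W 0, paths_c] ! i)"
    using std_join by (auto simp: mem_nats)
  then have "\<forall>f. NMem W f (Star W paths_c) \<longrightarrow> (\<forall>g. NMem W g (Star W paths_c) \<longrightarrow>
      (\<forall>n. n \<in> hypernat W \<longrightarrow> (\<forall>m. m \<in> hypernat W \<longrightarrow> star_path f n \<longrightarrow> star_path g m \<longrightarrow>
        (\<exists>h. NMem W h (Star W paths_c) \<and> (\<exists>l. l \<in> hypernat W \<and> star_join f n g m h l)))))"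
    unfolding transfer by (simp add: hypernat_iff)
  then obtain h l where h: "NMem W h (Star W paths_c)" and l: "l \<in> hypernat W"
    and hl: "star_join f n g m h l"
    using assms unfolding connects_def by metis
  have path: "star_path h l" using hl by (simp add: join_path_def)
  have f: "star_path f n" and g: "star_path g m"
    using assms by (simp_all add: connects_def)
  have fx: "rel (NMem W) f (Star W (num W 0)) x" and gy: "rel (NMem W) g (Star W (num W 0)) y"
    and fu: "rel (NMem W) f n u" and gv: "rel (NMem W) g m v"
    using assms by (simp_all add: connects_def)
  have hx: "rel (NMem W) h (Star W (num W 0)) x" and hy: "rel (NMem W) h l y"
    using hl fx gy star_path_dom(2)[OF f fx] star_path_dom(2)[OF g gy]
    unfolding join_path_def star_M_iff by blast+
  have INF: "w \<in> INF_pts W M d \<xi>" if "rel (NMem W) h i w" for i w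
  proof -
    have "\<exists>i'. rel (NMem W) f i' w \<or> rel (NMem W) g i' w"
      using hl that star_path_dom[OF path that]
      unfolding join_path_def star_M_iff hypernat_iff by blast
    then show ?thesis using assms unfolding connects_def by metis
  qed
  have steps: "sim W M d a b"
    if "(i, l) \<in> hypernat_less W" "(i, j) \<in> hypernat_succ W"
      "rel (NMem W) h i a" "rel (NMem W) h j b" for i j a b
  proof -
    have "rel (NMem W) f n a \<and> rel (NMem W) g m b \<or>
      (\<exists>i' j'. (i', j') \<in> hypernat_succ W \<and>
         ((i', n) \<in> hypernat_less W \<and> rel (NMem W) f i' a \<and> rel (NMem W) f j' b \<or>
          (i', m) \<in> hypernat_less W \<and> rel (NMem W) g i' b \<and> rel (NMem W) g j' a))"
      using hl that star_path_dom[OF path that(3)] star_path_dom[OF path that(4)]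
      unfolding join_path_def star_M_iff hypernat_iff hypernat_rel_iff by blast
    then show ?thesis
    proof (elim disjE conjE exE)
      assume "rel (NMem W) f n a" "rel (NMem W) g m b"
      then show ?thesis
        using assms(3) star_path_unique[OF f _ fu] star_path_unique[OF g _ gv] by metis
    next
      fix i' j'
      assume "(i', j') \<in> hypernat_succ W" "(i', n) \<in> hypernat_less W"
        "rel (NMem W) f i' a" "rel (NMem W) f j' b"
      then show ?thesis using assms(1) unfolding connects_def by metis
    next
      fix i' j'
      assume "(i', j') \<in> hypernat_succ W" "(i', m) \<in> hypernat_less W"
        "rel (NMem W) g i' b" "rel (NMem W) g j' a"
      then have "sim W M d b a" using assms(2) unfolding connects_def by metis
      then show ?thesis by (rule sim_sym)
    qed
  qed
  have "connects h l x y"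
    unfolding connects_def using h l path hx hy INF steps by metis
  then show ?thesis by blast
qed

subsection \<open>Segments of sequences\<close>

abbreviation "std_segment \<equiv> segment_path (Mem W) nats_c M_c le_c less_c succ_c (num W 0)"
abbreviation "star_segment \<equiv> segment_path (NMem W) (Star W nats_c) (Star W M_c) (Star W le_c)
  (Star W less_c) (Star W succ_c) (Star W (num W 0))"

lemma std_segment:
  assumes F: "\<And>y i. y \<in> M \<Longrightarrow> F y i \<in> M" and "p \<in> M" "a \<le> b"
  shows "\<exists>h l. Mem W h paths_c \<and>
    std_segment (code_rel3 (graph3 F)) p (num W a) (num W b) h (num W l)"
proof -
  define l where "l = b - a"
  obtain h where h: "Mem W h paths_c" "std_path h (num W l)"
    "\<And>i x. rel (Mem W) h (num W i) x \<longleftrightarrow> i \<le> l \<and> x = F p (a + i)"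
    using std_pathI[of l "\<lambda>i. F p (a + i)"] F assms(2) by metis
  have "std_segment (code_rel3 (graph3 F)) p (num W a) (num W b) h (num W l)"
    unfolding segment_path_def mem_nats mem_M rel_nats
    using h(2) assms(2,3)
    by (auto simp: h(3) rel3_graph3[OF F]) (auto simp: l_def intro: le_add1)
  with h(1) show ?thesis by blast
qed

text \<open>
  If the consecutive terms of every \<open>F y\<close> are within \<open>C\<close> and, for \<open>y\<close> close to \<open>x\<close> in the sense
  of the ultrafilter of \<open>x\<close>, the terms \<open>F y i\<close> leave every ball uniformly in \<open>y\<close>, then the values
  of the extended sequence at two infinite indices are equivalent.
\<close>

lemma connects_segment:
  assumes F: "\<And>y i. y \<in> M \<Longrightarrow> F y i \<in> M" "\<And>y i. y \<in> M \<Longrightarrow> (F y i, F y (Suc i)) \<in> near C"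
    and x: "x \<in> star_set W M"
    and far: "\<And>R. \<exists>K A. A \<subseteq> M \<and> x \<in> star_set W A \<and> (\<forall>y\<in>A. \<forall>i\<ge>K. F y i \<in> far R)"
    and ab: "a \<in> infinite_hypernat W" "(a, b) \<in> hypernat_le W"
    and uv: "star_fun F x a u" "u \<in> star_set W M" "star_fun F x b v" "v \<in> star_set W M"
  shows "(u, v) \<in> iota_rel W M d \<xi>"
proof -
  have a: "a \<in> hypernat W" and b: "b \<in> hypernat W" using hypernat_rel_dom(1)[OF ab(2)] by auto
  have "holds (Mem W) (All_in 8 1 (All_in 9 0 (All_in 10 0 (Imp (RelF 2 9 10)
        (Ex_in 11 6 (Ex_in 12 0 (SegmentF 0 1 2 3 4 5 7 8 9 10 11 12)))))))
      (\<lambda>i. [nats_c, M_c, le_c, less_c, succ_c, num W 0, paths_c, code_rel3 (graph3 F)] ! i)"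
    using std_segment[of F] F(1) by (auto simp: mem_nats mem_M rel_nats)
  then have "\<forall>p. p \<in> star_set W M \<longrightarrow> (\<forall>a. a \<in> hypernat W \<longrightarrow> (\<forall>b. b \<in> hypernat W \<longrightarrow>
      (a, b) \<in> hypernat_le W \<longrightarrow> (\<exists>h. NMem W h (Star W paths_c) \<and> (\<exists>l. l \<in> hypernat W \<and>
         star_segment (Star W (code_rel3 (graph3 F))) p a b h l))))"
    unfolding transfer by (simp add: hypernat_iff star_M_iff hypernat_rel_iff)
  then obtain h l where h: "NMem W h (Star W paths_c)" and l: "l \<in> hypernat W"
    and hl: "star_segment (Star W (code_rel3 (graph3 F))) x a b h l"
    using x ab a b by metis
  have path: "star_path h l" using hl by (simp add: segment_path_def)
  have hu: "rel (NMem W) h (Star W (num W 0)) u" and hv: "rel (NMem W) h l v"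
    using hl uv unfolding segment_path_def star_M_iff star_fun_def by blast+
  have INF: "w \<in> INF_pts W M d \<xi>" if hw: "rel (NMem W) h i w" for i w
  proof -
    have w: "w \<in> star_set W M" using star_path_dom[OF path hw] by simp
    obtain j where j: "(a, j) \<in> hypernat_le W" "star_fun F x j w"
      using hl hw star_path_dom[OF path hw]
      unfolding segment_path_def star_M_iff hypernat_iff hypernat_rel_iff star_fun_def by metis
    have "w \<in> star_set W (far R)" for R
    proof -
      obtain K A where A: "A \<subseteq> M" "x \<in> star_set W A" "\<And>y i. y \<in> A \<Longrightarrow> K \<le> i \<Longrightarrow> F y i \<in> far R"
        using far[of R] by blast
      have "(Star W (num W K), j) \<in> hypernat_le W"
        using infinite_hypernat_mono[OF ab(1) j(1)] infinite_hypernat_iff by blast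
      then show ?thesis
        using star_fun_values[where F = F, OF F(1) A(1) far_subset A(3) A(2) _ j(2) w] by simp
    qed
    with w show ?thesis by (simp add: INF_iff)
  qed
  have steps: "sim W M d w z"
    if ij: "(i, l) \<in> hypernat_less W" "(i, j) \<in> hypernat_succ W"
      "rel (NMem W) h i w" "rel (NMem W) h j z" for i j w z
  proof -
    have wz: "w \<in> star_set W M" "z \<in> star_set W M"
      using star_path_dom[OF path ij(3)] star_path_dom[OF path ij(4)] by simp_all
    obtain i' j' where "(i', j') \<in> hypernat_succ W" "star_fun F x i' w" "star_fun F x j' z"
      using hl ij star_path_dom[OF path ij(3)] star_path_dom[OF path ij(4)]
      unfolding segment_path_def star_M_iff hypernat_iff hypernat_rel_iff star_fun_def by metis
    then have "(w, z) \<in> star_rel W (near C)"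
      using star_fun_steps[where F = F, OF F(1) near_subset F(2) x] wz by blast
    then show ?thesis using sim_iff by blast
  qed
  have "connects h l u v"
    unfolding connects_def using h l path hu hv INF steps by metis
  then show ?thesis using iota_rel_iff by blast
qed

section \<open>Saturation and the equivalence relation\<close>

text \<open>
  Saturation is applied to the internal sets \<open>D n\<close> of all \<open>w \<ge> n\<close> with \<open>T x w\<close>, one for each
  standard \<open>n\<close>.  They decrease and, by assumption, \<open>n\<close> itself
  belongs to \<open>D n\<close>; a common element is infinite.
\<close>

lemma overspill:
  assumes T: "T \<subseteq> M \<times> nats" and x: "x \<in> star_set W M"
    and std: "\<And>n. (x, Star W (num W n)) \<in> star_rel W T"
  shows "\<exists>w\<in>infinite_hypernat W. (x, w) \<in> star_rel W T"
proof -
  \<comment> \<open>the power set of the natural numbers, needed to bound the quantifier over the sets \<open>D n\<close>\<close>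
  define Q where "Q = {a. a \<notin> Atoms W \<and> (\<forall>w. Mem W w a \<longrightarrow> w \<in> nats)}"
  have T_small: "T \<subseteq> level W k \<times> level W k" using T M_level num_level by blast
  have mem_Q: "Mem W a (code_set W Q) \<longleftrightarrow> a \<notin> Atoms W \<and> (\<forall>w. Mem W w a \<longrightarrow> w \<in> nats)" for a
  proof -
    have "Q \<subseteq> level W (k + 4)"
    proof
      fix a assume "a \<in> Q"
      then have "a \<in> level W (Suc k)"
        unfolding Q_def using num_level by (intro level_SucI) auto
      then show "a \<in> level W (k + 4)" using level_mono[of "Suc k" "k + 4" W] by auto
    qed
    then show ?thesis by (simp add: mem_code) (simp add: Q_def)
  qed
  have sections: "\<exists>D. Mem W D (code_set W Q) \<and> (\<forall>w. w \<in> nats \<longrightarrow>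
      (Mem W w D \<longleftrightarrow> (n, w) \<in> nat_le \<and> (y, w) \<in> T))" for y n
  proof -
    let ?A = "{w \<in> nats. (n, w) \<in> nat_le \<and> (y, w) \<in> T}"
    have "?A \<subseteq> level W k" using num_level by blast
    then have "code_set W ?A \<notin> Atoms W" "\<And>w. Mem W w (code_set W ?A) \<longleftrightarrow> w \<in> ?A"
      using code_set(1)[of ?A k] mem_code_small by auto
    then show ?thesis unfolding mem_Q by (intro exI[of _ "code_set W ?A"]) auto
  qed
  have "holds (Mem W) (All_in 5 1 (All_in 6 0 (Ex_in 7 4 (Conj (All_in 8 7 (Elem 8 0))
      (All_in 8 0 (Iff (Elem 8 7) (Conj (RelF 2 6 8) (RelF 3 5 8))))))))
      (\<lambda>i. [nats_c, M_c, le_c, code_rel W T, code_set W Q] ! i)"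
    using sections by (simp add: mem_M mem_nats rel_nats rel_code[OF T_small]) (metis mem_Q)
  then have star_sections: "\<forall>y. y \<in> star_set W M \<longrightarrow> (\<forall>n. n \<in> hypernat W \<longrightarrow>
      (\<exists>D. NMem W D (Star W (code_set W Q)) \<and> (\<forall>w. NMem W w D \<longrightarrow> w \<in> hypernat W) \<and>
        (\<forall>w. w \<in> hypernat W \<longrightarrow>
          (NMem W w D \<longleftrightarrow> (n, w) \<in> hypernat_le W \<and> (y, w) \<in> star_rel W T))))"
    unfolding transfer by (simp add: hypernat_iff star_M_iff hypernat_rel_iff star_rel_iff)
  have "\<exists>D. internal W D \<and> (\<forall>w. NMem W w D \<longrightarrow> w \<in> hypernat W) \<and>
      (\<forall>w. w \<in> hypernat W \<longrightarrow>
        (NMem W w D \<longleftrightarrow> (Star W (num W n), w) \<in> hypernat_le W \<and> (x, w) \<in> star_rel W T))" for n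
    using star_sections[rule_format, OF x Star_num_hypernat[of n]]
    unfolding internal_def by (rule ex_forward) blast
  then obtain D where D: "\<And>n. internal W (D n)" "\<And>n w. NMem W w (D n) \<Longrightarrow> w \<in> hypernat W"
    "\<And>n w. w \<in> hypernat W \<Longrightarrow>
       NMem W w (D n) \<longleftrightarrow> (Star W (num W n), w) \<in> hypernat_le W \<and> (x, w) \<in> star_rel W T"
    by metis
  define F where "F i = D (inv (num W) i)" for i
  have F: "F (num W n) = D n" for n by (simp add: F_def inv_f_f[OF inj_num])
  have "\<exists>v. \<forall>i. Mem W i nats_c \<longrightarrow> NMem W v (F i)"
  proof -
    have "\<exists>v. \<forall>i\<in>J. NMem W v (F i)" if J: "finite J" "J \<subseteq> nats" for J
    proof -
      obtain N where N: "finite N" "J = num W ` N"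
        using J by (meson finite_subset_image)
      have "NMem W (Star W (num W (Max N))) (D n)" if "n \<in> N" for n
        using Max_ge[OF N(1) that] D(3)[OF Star_num_hypernat] std hypernat_le_Star by simp
      then show ?thesis unfolding N(2) using F by auto
    qed
    moreover have "nats_c \<notin> Atoms W"
      using code_set(1)[OF num_level] by simp
    moreover have "{i. Mem W i nats_c} = nats" by (simp add: mem_nats)
    moreover have "internal W (F i)" if "Mem W i nats_c" for i
      using that D(1) F by (auto simp: mem_nats)
    ultimately show ?thesis
      using sat unfolding saturation_principle_def by metis
  qed
  then obtain w where "\<And>n. NMem W w (D n)" using F mem_nats by (metis rangeI)
  moreover from this have "w \<in> hypernat W" by (rule D(2))
  ultimately have "w \<in> infinite_hypernat W" "(x, w) \<in> star_rel W T"
    using D(3) by (simp_all add: infinite_hypernat_iff)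
  then show ?thesis by (rule bexI[rotated])
qed

lemma ex_infinite: "\<exists>w. w \<in> infinite_hypernat W"
proof -
  have "M \<times> nats \<subseteq> level W k \<times> level W k" using M_level num_level by blast
  then have "(Star W \<xi>, Star W (num W n)) \<in> star_rel W (M \<times> nats)" for n
    using base_point by (simp add: star_rel_Star)
  then show ?thesis
    using overspill[of "M \<times> nats" "Star W \<xi>"] base_point Star_in_star_set[OF M_level] by blast
qed

lemma star_fun_eventually:
  assumes F: "\<And>y i. y \<in> M \<Longrightarrow> F y i \<in> M" "\<And>y. y \<in> M \<Longrightarrow> \<exists>K. \<forall>i\<ge>K. F y i = y"
    and x: "x \<in> star_set W M" and w: "w \<in> hypernat W"
  shows "\<exists>b. (w, b) \<in> hypernat_le W \<and> star_fun F x b x"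
proof -
  have "\<exists>b. m \<le> b \<and> y = F y b" if "y \<in> M" for y m
    using F(2)[OF that] by (metis nat_le_linear)
  then have "holds (Mem W) (All_in 4 1 (All_in 5 0 (Ex_in 6 0 (Conj (RelF 2 5 6) (Rel3F 3 4 6 4)))))
      (\<lambda>i. [nats_c, M_c, le_c, code_rel3 (graph3 F)] ! i)"
    by (auto simp: mem_nats mem_M rel_nats rel3_graph3[OF F(1)])
  then have "\<forall>y. y \<in> star_set W M \<longrightarrow> (\<forall>w. w \<in> hypernat W \<longrightarrow>
      (\<exists>b. b \<in> hypernat W \<and> (w, b) \<in> hypernat_le W \<and> star_fun F y b y))"
    unfolding transfer by (simp add: hypernat_iff star_M_iff hypernat_rel_iff star_fun_def)
  with x w show ?thesis by blast
qed

text \<open>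
  Applied to the family of constant sequences, \<open>connects_segment\<close> yields a path of length zero.
\<close>

lemma iota_refl:
  assumes "x \<in> INF_pts W M d \<xi>"
  shows "(x, x) \<in> iota_rel W M d \<xi>"
proof -
  obtain w where w: "w \<in> infinite_hypernat W" using ex_infinite by blast
  have x: "x \<in> star_set W M" using assms by (rule INF_star_M)
  obtain b where b: "(w, b) \<in> hypernat_le W" "star_fun (\<lambda>y _. y) x b x"
    using star_fun_eventually[of "\<lambda>y _. y" x w] x w by (auto simp: infinite_hypernat_def)
  have "b \<in> infinite_hypernat W" "(b, b) \<in> hypernat_le W"
    using infinite_hypernat_mono[OF w b(1)] hypernat_le_linear[of b b]
    by (simp_all add: infinite_hypernat_def)
  moreover have "\<exists>K A. A \<subseteq> M \<and> x \<in> star_set W A \<and> (\<forall>y\<in>A. \<forall>i\<ge>K. y \<in> far R)" for R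
    using assms far_subset[of R] unfolding INF_iff by blast
  ultimately show ?thesis
    using b(2) x by (intro connects_segment[where F = "\<lambda>y _. y" and C = 0]) (auto simp: near_def)
qed

lemma sim_refl:
  assumes "x \<in> star_set W M"
  shows "sim W M d x x"
proof -
  have "holds (Mem W) (All_in 2 0 (RelF 1 2 2)) (\<lambda>i. [M_c, code_rel W (near 0)] ! i)"
    using rel_M_small[OF near_subset] by (auto simp: mem_M rel_code) (auto simp: near_def)
  then show ?thesis
    unfolding transfer sim_iff star_rel_iff using assms by (auto simp: star_M_iff)
qed

text \<open>
  With reflexivity this one rule gives symmetry and transitivity.
\<close>

lemma iota_join:
  "(x, u) \<in> iota_rel W M d \<xi> \<Longrightarrow> (y, v) \<in> iota_rel W M d \<xi> \<Longrightarrow> sim W M d u v \<Longrightarrow>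
     (x, y) \<in> iota_rel W M d \<xi>"
  unfolding iota_rel_iff using connects_join by blast

lemma iota_INF: "(x, y) \<in> iota_rel W M d \<xi> \<Longrightarrow> x \<in> INF_pts W M d \<xi> \<and> y \<in> INF_pts W M d \<xi>"
  by (auto simp: iota_rel_def)

lemma iota_sym:
  assumes "(x, y) \<in> iota_rel W M d \<xi>"
  shows "(y, x) \<in> iota_rel W M d \<xi>"
  using iota_join[OF iota_refl assms sim_refl] iota_INF[OF assms] INF_star_M by blast

lemma iota_trans:
  assumes "(x, y) \<in> iota_rel W M d \<xi>" "(y, z) \<in> iota_rel W M d \<xi>"
  shows "(x, z) \<in> iota_rel W M d \<xi>"
  using iota_join[OF assms(1) iota_sym[OF assms(2)] sim_refl] iota_INF[OF assms(1)] INF_star_M by blast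

lemma iota_class_eq:
  assumes "(x, y) \<in> iota_rel W M d \<xi>"
  shows "iota_rel W M d \<xi> `` {x} = iota_rel W M d \<xi> `` {y}"
  using assms iota_sym iota_trans by blast

section \<open>The comparison map\<close>

lemma coarse_seq_steps:
  assumes "s \<in> coarse_seqs M d \<xi>"
  shows "\<exists>C. \<forall>i. (s i, s (Suc i)) \<in> near C"
proof -
  have "{(i, Suc i) | i. True} \<in> nat_coarse"
    unfolding nat_coarse_def bounded_coarse_def bdd_above_def by auto
  then have "map_prod s s ` {(i, Suc i) | i. True} \<in> bounded_coarse M d"
    using assms by (simp add: coarse_seqs_def bornologous_def)
  then obtain B where "\<And>p. p \<in> map_prod s s ` {(i, Suc i) | i. True} \<Longrightarrow> (case p of (x, y) \<Rightarrow> d x y) \<le> B"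
    unfolding bounded_coarse_def bdd_above_def by blast
  then have "d (s i) (s (Suc i)) \<le> B" for i by force
  then have "d (s i) (s (Suc i)) \<le> real (nat \<lceil>B\<rceil>)" for i
    using real_nat_ceiling_ge order_trans by blast
  then have "(s i, s (Suc i)) \<in> near (nat \<lceil>B\<rceil>)" for i
    using assms by (auto simp: near_def coarse_seqs_def)
  then show ?thesis by blast
qed

lemma coarse_seq_far:
  assumes "s \<in> coarse_seqs M d \<xi>"
  shows "\<exists>K. \<forall>i\<ge>K. s i \<in> far R"
proof -
  define B where "B = {y \<in> M. d y \<xi> \<le> real R}"
  have "d x y \<le> 2 * real R" if "x \<in> B" "y \<in> B" for x y
    using that base_point triangle[of x \<xi> y] commute[of y \<xi>] by (auto simp: B_def)
  then have "coarse_bounded (bounded_coarse M d) B"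
    unfolding coarse_bounded_def bounded_coarse_def bdd_above_def
    by (auto simp: B_def intro!: exI[of _ "2 * real R"])
  moreover have "\<xi> \<in> B" using base_point by (simp add: B_def)
  ultimately have "coarse_bounded nat_coarse (s -` B \<inter> UNIV)"
    using assms by (simp add: coarse_seqs_def coarse_proper_def)
  then obtain c where c: "\<And>i j. s i \<in> B \<Longrightarrow> s j \<in> B \<Longrightarrow> \<bar>real i - real j\<bar> \<le> c"
    unfolding coarse_bounded_def nat_coarse_def bounded_coarse_def bdd_above_def by fastforce
  have "s 0 \<in> B" using assms \<open>\<xi> \<in> B\<close> by (simp add: coarse_seqs_def)
  have "s i \<in> far R" if i: "i \<ge> nat \<lceil>c\<rceil> + 1" for i
  proof (rule ccontr)
    assume "s i \<notin> far R"
    then have "s i \<in> B" using assms by (auto simp: B_def far_def coarse_seqs_def)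
    then have "real i \<le> c" using c[OF _ \<open>s 0 \<in> B\<close>] by auto
    then show False using i by linarith
  qed
  then show ?thesis by blast
qed

lemma star_seq_iota:
  assumes s: "s \<in> coarse_seqs M d \<xi>"
    and w: "w \<in> infinite_hypernat W" "w' \<in> infinite_hypernat W"
  shows "(star_seq W s w, star_seq W s w') \<in> iota_rel W M d \<xi>"
proof -
  have range: "range s \<subseteq> M" using s by (simp add: coarse_seqs_def)
  obtain C where C: "\<And>i. (s i, s (Suc i)) \<in> near C" using coarse_seq_steps[OF s] by blast
  have \<xi>: "Star W \<xi> \<in> star_set W M" by (simp add: Star_in_star_set M_level base_point)
  have le: "(star_seq W s a, star_seq W s b) \<in> iota_rel W M d \<xi>"
    if ab: "a \<in> infinite_hypernat W" "(a, b) \<in> hypernat_le W" for a b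
  proof (rule connects_segment[where F = "\<lambda>_. s" and x = "Star W \<xi>" and C = C, OF _ C \<xi> _ ab])
    show "\<exists>K A. A \<subseteq> M \<and> Star W \<xi> \<in> star_set W A \<and> (\<forall>y\<in>A. \<forall>i\<ge>K. s i \<in> far R)" for R
      using coarse_seq_far[OF s] \<xi> by blast
    have "a \<in> hypernat W" "b \<in> hypernat W" using hypernat_rel_dom(1)[OF ab(2)] by auto
    then show "star_fun (\<lambda>_. s) (Star W \<xi>) a (star_seq W s a)"
      "star_fun (\<lambda>_. s) (Star W \<xi>) b (star_seq W s b)"
      "star_seq W s a \<in> star_set W M" "star_seq W s b \<in> star_set W M"
      using star_fun_star_seq[OF range \<xi>] star_seq(1)[OF range M_level] by blast+
  qed (use range in auto)
  have "w \<in> hypernat W" "w' \<in> hypernat W" using w by (simp_all add: infinite_hypernat_def)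
  then show ?thesis
    using hypernat_le_linear[of w w'] le[OF w(1)] le[OF w(2)] iota_sym by blast
qed

text \<open>
  The value of \<open>s = t \<circ> \<kappa>\<close> at \<open>w\<close> is the value of \<open>t\<close> at the value of \<open>\<kappa>\<close> at \<open>w\<close>, which is
  infinite since \<open>i \<le> \<kappa> i\<close> for all \<open>i\<close>.
\<close>

lemma star_seq_subseq:
  assumes s: "range s \<subseteq> M" and t: "range t \<subseteq> M" and "subseq_of s t"
    and w: "w \<in> infinite_hypernat W"
  shows "\<exists>w'\<in>infinite_hypernat W. star_seq W s w = star_seq W t w'"
proof -
  obtain \<kappa> where \<kappa>: "strict_mono \<kappa>" "s = t \<circ> \<kappa>"
    using assms(3) by (auto simp: subseq_of_def)
  define k' where "k' = (\<lambda>n. num W (\<kappa> n))"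
  define w' where "w' = star_seq W k' w"
  have k': "range k' \<subseteq> nats" by (auto simp: k'_def)
  have wN: "w \<in> hypernat W" using w by (simp add: infinite_hypernat_def)
  have w': "w' \<in> hypernat W" "(w, w') \<in> star_rel W (graph k')"
    using star_seq[OF k' num_level wN] by (simp_all add: w'_def hypernat_def)
  have rels: "range s \<subseteq> level W k" "range t \<subseteq> level W k" "range k' \<subseteq> level W k"
    by (rule order_trans[OF s M_level] order_trans[OF t M_level] order_trans[OF k' num_level])+
  have "holds (Mem W) (All_in 6 0 (All_in 7 0 (All_in 8 1 (Imp (RelF 3 6 7)
      (Conj (RelF 2 6 7) (Imp (RelF 4 7 8) (RelF 5 6 8)))))))
      (\<lambda>i. [nats_c, M_c, le_c, code_rel W (graph k'), code_rel W (graph t), code_rel W (graph s)] ! i)"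
    using strict_mono_imp_increasing[OF \<kappa>(1)]
    by (auto simp: mem_nats mem_M rel_nats rel_graph[OF rels(1)] rel_graph[OF rels(2)]
        rel_graph[OF rels(3)]) (auto simp: k'_def \<kappa>(2))
  then have "\<forall>i. i \<in> hypernat W \<longrightarrow> (\<forall>j. j \<in> hypernat W \<longrightarrow> (\<forall>x. x \<in> star_set W M \<longrightarrow>
      (i, j) \<in> star_rel W (graph k') \<longrightarrow> (i, j) \<in> hypernat_le W \<and>
      ((j, x) \<in> star_rel W (graph t) \<longrightarrow> (i, x) \<in> star_rel W (graph s))))"
    unfolding transfer by (simp add: hypernat_iff star_M_iff hypernat_rel_iff star_rel_iff)
  moreover have tw: "star_seq W t w' \<in> star_set W M" "(w', star_seq W t w') \<in> star_rel W (graph t)"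
    using star_seq[OF t M_level w'(1)] by simp_all
  ultimately have "(w, w') \<in> hypernat_le W" "(w, star_seq W t w') \<in> star_rel W (graph s)"
    using w' wN by blast+
  then have "w' \<in> infinite_hypernat W" "star_seq W s w = star_seq W t w'"
    using infinite_hypernat_mono[OF w] star_seq(2)[OF s M_level wN] by simp_all
  then show ?thesis by blast
qed

text \<open>
  The relation of having the same class at a fixed infinite index \<open>w\<close> is an equivalence relation
  containing the subsequence relation, hence it contains \<open>sigma_rel\<close>.
\<close>

lemma omega_map_class:
  assumes s: "s \<in> coarse_seqs M d \<xi>" and w: "w \<in> infinite_hypernat W"
  shows "omega_map W M d \<xi> (sigma_rel M d \<xi> `` {s}) = iota_rel W M d \<xi> `` {star_seq W s w}"
proof -
  let ?S = "coarse_seqs M d \<xi>" and ?cls = "\<lambda>s. iota_rel W M d \<xi> `` {star_seq W s w}"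
  let ?r = "{(s, t). s \<in> ?S \<and> t \<in> ?S \<and> ?cls s = ?cls t}"
  have cls: "iota_rel W M d \<xi> `` {star_seq W t w'} = ?cls t"
    if "t \<in> ?S" "w' \<in> infinite_hypernat W" for t w'
    using iota_class_eq[OF star_seq_iota[OF that w]] .
  have "?cls s = ?cls t" if st: "s \<in> ?S" "t \<in> ?S" "subseq_of s t" for s t
  proof -
    have "range s \<subseteq> M" "range t \<subseteq> M" using st by (auto simp: coarse_seqs_def)
    then show ?thesis using star_seq_subseq[OF _ _ st(3) w] cls[OF st(2)] by fastforce
  qed
  moreover have "equiv ?S ?r"
    by (rule equivI) (auto simp: refl_on_def sym_def trans_def)
  ultimately have "sigma_rel M d \<xi> \<subseteq> ?r"
    unfolding sigma_rel_def by (intro Inter_lower) auto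
  moreover have "(s, s) \<in> sigma_rel M d \<xi>"
    using s unfolding sigma_rel_def equiv_def refl_on_def by blast
  ultimately have members: "s \<in> sigma_rel M d \<xi> `` {s}"
    "\<And>t. t \<in> sigma_rel M d \<xi> `` {s} \<Longrightarrow> t \<in> ?S \<and> ?cls s = ?cls t"
    by auto
  show ?thesis
    unfolding omega_map_def
  proof (rule the_equality)
    show "\<exists>t\<in>sigma_rel M d \<xi> `` {s}. \<exists>w'\<in>infinite_hypernat W.
        ?cls s = iota_rel W M d \<xi> `` {star_seq W t w'}"
      using members(1) w by (intro bexI) (rule refl)
    fix C assume "\<exists>t\<in>sigma_rel M d \<xi> `` {s}. \<exists>w'\<in>infinite_hypernat W.
        C = iota_rel W M d \<xi> `` {star_seq W t w'}"
    then obtain t w' where t: "t \<in> sigma_rel M d \<xi> `` {s}" "w' \<in> infinite_hypernat W"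
      "C = iota_rel W M d \<xi> `` {star_seq W t w'}" by (elim bexE)
    then show "C = ?cls s" using members(2)[OF t(1)] cls[OF _ t(2)] by simp
  qed
qed

subsection \<open>Geodesics and approximating sequences\<close>

lemma far_infinite:
  assumes "x \<in> INF_pts W M d \<xi>"
  shows "x \<in> star_set W (far R)"
  using assms by (simp add: INF_iff)

lemma star_set_meet:
  assumes "A \<subseteq> level W k" "B \<subseteq> level W k" "x \<in> star_set W A" "x \<in> star_set W B"
  shows "\<exists>y. y \<in> A \<and> y \<in> B"
  using star_set_Int[OF assms] star_set_empty by (cases "A \<inter> B = {}") auto

text \<open>
  The geodesic from \<open>\<xi>\<close> to \<open>y\<close> is sampled at the natural numbers up to \<open>d \<xi> y\<close>, and the
  sequence is constantly \<open>y\<close> afterwards.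
\<close>

lemma geodesic_family:
  assumes "geodesic_metric M d"
  obtains F where "\<And>y i. y \<in> M \<Longrightarrow> F y i \<in> M"
    "\<And>y i j. y \<in> M \<Longrightarrow> d (F y i) (F y j) \<le> \<bar>real i - real j\<bar>"
    "\<And>y i. y \<in> M \<Longrightarrow> d (F y i) \<xi> = min (real i) (d y \<xi>)"
    "\<And>y. y \<in> M \<Longrightarrow> \<exists>K. \<forall>i\<ge>K. F y i = y"
proof -
  have "\<forall>y\<in>M. \<exists>g :: real \<Rightarrow> 'u. g 0 = \<xi> \<and> g (d \<xi> y) = y \<and> g ` {0..d \<xi> y} \<subseteq> M \<and>
      (\<forall>s\<in>{0..d \<xi> y}. \<forall>t\<in>{0..d \<xi> y}. d (g s) (g t) = \<bar>s - t\<bar>)"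
    using assms base_point unfolding geodesic_metric_def by blast
  then obtain g :: "'u \<Rightarrow> real \<Rightarrow> 'u" where g: "\<forall>y\<in>M. g y 0 = \<xi> \<and> g y (d \<xi> y) = y \<and>
      g y ` {0..d \<xi> y} \<subseteq> M \<and> (\<forall>s\<in>{0..d \<xi> y}. \<forall>t\<in>{0..d \<xi> y}. d (g y s) (g y t) = \<bar>s - t\<bar>)"
    by (rule bchoice[THEN exE])
  define F where "F y i = g y (min (real i) (d \<xi> y))" for y i
  have range: "min (real i) (d \<xi> y) \<in> {0..d \<xi> y}" for i y by simp
  have dist: "d (g y s) (g y t) = \<bar>s - t\<bar>" if "y \<in> M" "s \<in> {0..d \<xi> y}" "t \<in> {0..d \<xi> y}" for y s t
    using g that by blast
  show thesis
  proof (rule that[of F])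
    fix y i assume y: "y \<in> M"
    show "F y i \<in> M" using g y range[of i y] unfolding F_def by blast
    show "d (F y i) (F y j) \<le> \<bar>real i - real j\<bar>" for j
      unfolding F_def dist[OF y range range] by linarith
    have "d (F y i) (g y 0) = \<bar>min (real i) (d \<xi> y) - 0\<bar>"
      unfolding F_def by (rule dist[OF y range]) simp
    then show "d (F y i) \<xi> = min (real i) (d y \<xi>)"
      using g y by (simp add: commute[of \<xi> y])
  next
    fix y assume y: "y \<in> M"
    have "F y i = y" if "nat \<lceil>d \<xi> y\<rceil> \<le> i" for i
    proof -
      have "d \<xi> y \<le> real i" using that by linarith
      then have "min (real i) (d \<xi> y) = d \<xi> y" by simp
      then show ?thesis using g y unfolding F_def by metis
    qed
    then show "\<exists>K. \<forall>i\<ge>K. F y i = y" by blast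
  qed
qed

lemma proper_finite_net:
  assumes "proper_metric M d"
  shows "\<exists>K. finite K \<and> K \<subseteq> M \<and> (\<forall>y\<in>M. d y \<xi> \<le> r \<longrightarrow> (\<exists>c\<in>K. d c y \<le> 1))"
proof -
  have "closedin mtopology (mcball \<xi> r)" "mbounded (mcball \<xi> r)" by (simp_all add: mbounded_mcball)
  then have "compactin mtopology (mcball \<xi> r)"
    using assms unfolding proper_metric_def by blast
  then have "mtotally_bounded (mcball \<xi> r)" by (rule compactin_imp_mtotally_bounded)
  then obtain K where K: "finite K" "K \<subseteq> mcball \<xi> r" "mcball \<xi> r \<subseteq> (\<Union>c\<in>K. mball c 1)"
    unfolding mtotally_bounded_def by (meson zero_less_one)
  have "\<exists>c\<in>K. d c y \<le> 1" if "y \<in> M" "d y \<xi> \<le> r" for y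
  proof -
    have "y \<in> mcball \<xi> r" using that base_point by (simp add: commute)
    then obtain c where "c \<in> K" "y \<in> mball c 1" using K(3) by blast
    then show ?thesis by (intro bexI[of _ c]) auto
  qed
  moreover have "K \<subseteq> M" using K(2) by auto
  ultimately show ?thesis using K(1) by blast
qed

lemma coarse_seqI:
  assumes s: "range s \<subseteq> M" "s 0 = \<xi>"
    and upper: "\<And>m n. d (s m) (s n) \<le> \<bar>real m - real n\<bar> + a"
    and lower: "\<And>n. real n - b \<le> d (s n) \<xi>"
  shows "s \<in> coarse_seqs M d \<xi>"
proof -
  have sM: "s n \<in> M" for n using s by auto
  have "coarse_bounded nat_coarse (s -` B \<inter> UNIV)"
    if B: "coarse_bounded (bounded_coarse M d) B" "\<xi> \<in> B" for B
  proof -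
    obtain c where c: "\<And>x y. x \<in> B \<Longrightarrow> y \<in> B \<Longrightarrow> d x y \<le> c"
      using B(1) unfolding coarse_bounded_def bounded_coarse_def bdd_above_def by fastforce
    have n: "real n \<le> c + b" if "s n \<in> B" for n
      using c[OF that B(2)] lower[of n] by linarith
    have "\<bar>real m - real n\<bar> \<le> c + b" if "s m \<in> B" "s n \<in> B" for m n
      using n[OF that(1)] n[OF that(2)] by linarith
    then show ?thesis
      unfolding coarse_bounded_def nat_coarse_def bounded_coarse_def bdd_above_def by auto
  qed
  moreover have "map_prod s s ` E \<in> bounded_coarse M d" if E: "E \<in> nat_coarse" for E
  proof -
    obtain c where c: "\<And>m n. (m, n) \<in> E \<Longrightarrow> \<bar>real m - real n\<bar> \<le> c"
      using E unfolding nat_coarse_def bounded_coarse_def bdd_above_def by fastforce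
    have "d (s m) (s n) \<le> c + a" if "(m, n) \<in> E" for m n
      using c[OF that] upper[of m n] by linarith
    then show ?thesis
      using sM unfolding bounded_coarse_def bdd_above_def by (auto intro!: exI[of _ "c + a"])
  qed
  ultimately show ?thesis
    using s unfolding coarse_seqs_def coarse_proper_def bornologous_def by blast
qed

lemma ex_coarse_seq:
  assumes proper: "proper_metric M d" and geodesic: "geodesic_metric M d"
    and x: "x \<in> INF_pts W M d \<xi>"
  shows "\<exists>s\<in>coarse_seqs M d \<xi>. \<exists>w\<in>infinite_hypernat W. (star_seq W s w, x) \<in> iota_rel W M d \<xi>"
proof -
  have xM: "x \<in> star_set W M" using x by (rule INF_star_M)
  obtain F where F: "\<And>y i. y \<in> M \<Longrightarrow> F y i \<in> M"
    and F_dist: "\<And>y i j. y \<in> M \<Longrightarrow> d (F y i) (F y j) \<le> \<bar>real i - real j\<bar>"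
    and F_base: "\<And>y i. y \<in> M \<Longrightarrow> d (F y i) \<xi> = min (real i) (d y \<xi>)"
    and F_end: "\<And>y. y \<in> M \<Longrightarrow> \<exists>K. \<forall>i\<ge>K. F y i = y"
    using that by (rule geodesic_family[OF geodesic])
  \<comment> \<open>the endpoints whose geodesic passes within \<open>1\<close> of \<open>c\<close> at time \<open>n\<close>\<close>
  define A where "A c n = {y \<in> M. d c (F y n) \<le> 1}" for c n
  have A_small: "A c n \<subseteq> level W k" for c n using M_level by (auto simp: A_def)
  have "\<exists>c. c \<in> M \<and> x \<in> star_set W (A c n) \<and> (n = 0 \<longrightarrow> c = \<xi>)" for n
  proof (cases "n = 0")
    case True
    have "A \<xi> n = M"
      using F_base[of _ 0] True by (auto simp: A_def commute[of \<xi>])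
    then show ?thesis using xM base_point by auto
  next
    case False
    obtain K where K: "finite K" "K \<subseteq> M" "\<And>y. y \<in> M \<Longrightarrow> d y \<xi> \<le> real n \<Longrightarrow> \<exists>c\<in>K. d c y \<le> 1"
      using proper_finite_net[OF proper, of "real n"] by blast
    have "M \<subseteq> (\<Union>c\<in>K. A c n)"
      using K(3)[OF F] F_base by (auto simp: A_def)
    then have "\<exists>c\<in>K. x \<in> star_set W (A c n)"
      using K(1) A_small xM by (intro star_set_finite_UN)
    then show ?thesis using False K(2) by blast
  qed
  then obtain s where s: "\<And>n. s n \<in> M" "\<And>n. x \<in> star_set W (A (s n) n)" "s 0 = \<xi>"
    by metis
  have upper: "d (s m) (s n) \<le> \<bar>real m - real n\<bar> + 2" for m n
  proof -
    obtain y where y: "y \<in> A (s m) m" "y \<in> A (s n) n"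
      using star_set_meet[OF A_small A_small s(2) s(2)] by blast
    then have "y \<in> M" "d (s m) (F y m) \<le> 1" "d (s n) (F y n) \<le> 1" by (auto simp: A_def)
    moreover have "d (s m) (s n) \<le> d (s m) (F y m) + d (F y m) (s n)"
      "d (F y m) (s n) \<le> d (F y m) (F y n) + d (F y n) (s n)"
      using \<open>y \<in> M\<close> s(1) F triangle by auto
    ultimately show ?thesis using F_dist[of y m n] commute[of "F y n" "s n"] by linarith
  qed
  \<comment> \<open>for an endpoint farther than \<open>n\<close> from \<open>\<xi>\<close> the geodesic is at distance \<open>n\<close> at time \<open>n\<close>\<close>
  have lower: "real n - 1 \<le> d (s n) \<xi>" for n
  proof -
    obtain y where y: "y \<in> A (s n) n" "y \<in> far n"
      using star_set_meet[OF A_small subset_M_small[OF far_subset] s(2) far_infinite[OF x]] by blast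
    then have "y \<in> M" "d (s n) (F y n) \<le> 1" "real n < d y \<xi>" by (auto simp: A_def far_def)
    moreover have "d (F y n) \<xi> \<le> d (F y n) (s n) + d (s n) \<xi>"
      using \<open>y \<in> M\<close> s(1) F triangle base_point by auto
    ultimately show ?thesis using F_base[of y n] commute[of "F y n" "s n"] by simp
  qed
  have range: "range s \<subseteq> M" using s(1) by auto
  have coarse: "s \<in> coarse_seqs M d \<xi>"
    using range s(3) upper lower by (rule coarse_seqI)
  define T where "T = {(y, num W n) | y n. y \<in> A (s n) n}"
  have T: "T \<subseteq> M \<times> nats" by (auto simp: T_def A_def)
  have "(x, Star W (num W n)) \<in> star_rel W T" for n
  proof -
    have "{y. (y, num W n) \<in> T} = A (s n) n" by (auto simp: T_def)
    then show ?thesis using star_rel_section[OF T M_level num_level rangeI] s(2) by simp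
  qed
  then obtain w where w: "w \<in> infinite_hypernat W" "(x, w) \<in> star_rel W T"
    using overspill[OF T xM] by blast
  have wN: "w \<in> hypernat W" using w(1) by (simp add: infinite_hypernat_def)
  obtain v where v: "v \<in> star_set W M" "star_fun F x w v"
    using star_fun_total[of F x w] F xM wN by blast
  define u where "u = star_seq W s w"
  have u: "u \<in> star_set W M" "(w, u) \<in> star_rel W (graph s)"
    using star_seq[OF range M_level wN] by (simp_all add: u_def)
  have T_small: "T \<subseteq> level W k \<times> level W k"
    using T Sigma_mono[OF M_level num_level] by (rule order_trans)
  have "holds (Mem W) (All_in 6 1 (All_in 7 0 (All_in 8 1 (All_in 9 1
      (Imp (RelF 2 6 7) (Imp (RelF 3 7 8) (Imp (Rel3F 4 6 7 9) (RelF 5 8 9))))))))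
      (\<lambda>i. [nats_c, M_c, code_rel W T, code_rel W (graph s), code_rel3 (graph3 F), code_rel W (near 1)] ! i)"
    by (auto simp: mem_nats mem_M rel_code[OF T_small] rel_graph[OF subset_M_small[OF range]]
        rel3_graph3[OF F] rel_code[OF rel_M_small[OF near_subset]]) (auto simp: T_def A_def near_def)
  then have "\<forall>y. y \<in> star_set W M \<longrightarrow> (\<forall>w. w \<in> hypernat W \<longrightarrow> (\<forall>u. u \<in> star_set W M \<longrightarrow>
      (\<forall>v. v \<in> star_set W M \<longrightarrow> (y, w) \<in> star_rel W T \<longrightarrow> (w, u) \<in> star_rel W (graph s) \<longrightarrow>
        star_fun F y w v \<longrightarrow> (u, v) \<in> star_rel W (near 1))))"
    unfolding transfer by (simp add: hypernat_iff star_M_iff star_rel_iff star_fun_def)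
  then have "(u, v) \<in> star_rel W (near 1)"
    using xM wN u v w(2) by blast
  then have sim: "sim W M d u v" using sim_iff by blast
  obtain b where b: "(w, b) \<in> hypernat_le W" "star_fun F x b x"
    using star_fun_eventually[of F x w] F F_end xM wN by blast
  have vx: "(v, x) \<in> iota_rel W M d \<xi>"
  proof (rule connects_segment[where F = F and x = x and C = 1, OF F _ xM _ w(1) b(1) v(2,1) b(2) xM])
    show "(F y i, F y (Suc i)) \<in> near 1" if "y \<in> M" for y i
      using F_dist[OF that, of i "Suc i"] F that by (simp add: near_def)
    show "\<exists>K A. A \<subseteq> M \<and> x \<in> star_set W A \<and> (\<forall>y\<in>A. \<forall>i\<ge>K. F y i \<in> far R)" for R
    proof (intro exI conjI ballI allI impI)
      show "x \<in> star_set W (far R)" by (rule far_infinite[OF x])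
      show "F y i \<in> far R" if "y \<in> far R" "Suc R \<le> i" for y i
        using that F F_base by (auto simp: far_def)
    qed (rule far_subset)
  qed
  have "u \<in> INF_pts W M d \<xi>"
    using star_seq_iota[OF coarse w(1) w(1)] iota_INF by (auto simp: u_def)
  then have "(u, v) \<in> iota_rel W M d \<xi>"
    using iota_join[OF iota_refl iota_refl sim] iota_INF[OF vx] by blast
  then have "(u, x) \<in> iota_rel W M d \<xi>" using vx by (rule iota_trans)
  then show ?thesis using coarse w(1) by (auto simp: u_def)
qed

end

theorem theorem4p2:
  fixes W :: "('u, 'v) universe"
    and M :: "'u set" and d :: "'u \<Rightarrow> 'u \<Rightarrow> real" and \<xi> :: 'u
  assumes "nonstandard_universe W"
    and "lives_in M W"
    and "Metric_space M d"
    and "proper_metric M d"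
    and "geodesic_metric M d"
    and "\<xi> \<in> M"
  shows "omega_map W M d \<xi> ` sigma_inv M d \<xi> = iota_inv W M d \<xi>"
proof -
  obtain k1 k2 where k1: "range (num W) \<subseteq> level W k1" "enat (k1 + 5) \<le> height W"
    and k2: "M \<subseteq> level W k2" "enat (k2 + 5) \<le> height W"
    using assms(1,2) unfolding nonstandard_universe_def lives_in_def by blast
  \<comment> \<open>the numbers and the points are coded over a common level\<close>
  define k where "k = max k1 k2"
  have "level W k1 \<subseteq> level W k" "level W k2 \<subseteq> level W k" "enat (k + 5) \<le> height W"
    using k1(2) k2(2) by (simp_all add: k_def level_mono max_def)
  then interpret coded_metric_space W k M d \<xi>
    using assms k1(1) k2(1)
    by (intro coded_metric_space.intro coded_universe.intro coded_metric_space_axioms.intro) auto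
  obtain w0 where w0: "w0 \<in> infinite_hypernat W" using ex_infinite by blast
  show ?thesis
  proof (intro equalityI subsetI)
    fix C assume "C \<in> omega_map W M d \<xi> ` sigma_inv M d \<xi>"
    then obtain s where s: "s \<in> coarse_seqs M d \<xi>"
      and C: "C = omega_map W M d \<xi> (sigma_rel M d \<xi> `` {s})"
      by (auto simp: sigma_inv_def quotient_def)
    have "star_seq W s w0 \<in> INF_pts W M d \<xi>"
      using star_seq_iota[OF s w0 w0] iota_INF by blast
    then show "C \<in> iota_inv W M d \<xi>"
      unfolding C omega_map_class[OF s w0] iota_inv_def by (rule quotientI)
  next
    fix C assume "C \<in> iota_inv W M d \<xi>"
    then obtain x where x: "x \<in> INF_pts W M d \<xi>" and C: "C = iota_rel W M d \<xi> `` {x}"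
      unfolding iota_inv_def by (rule quotientE)
    obtain s w where s: "s \<in> coarse_seqs M d \<xi>" and w: "w \<in> infinite_hypernat W"
      and sx: "(star_seq W s w, x) \<in> iota_rel W M d \<xi>"
      using ex_coarse_seq[OF assms(4,5) x] by blast
    have "C = omega_map W M d \<xi> (sigma_rel M d \<xi> `` {s})"
      unfolding C omega_map_class[OF s w] by (rule iota_class_eq[OF sx, symmetric])
    then show "C \<in> omega_map W M d \<xi> ` sigma_inv M d \<xi>"
      unfolding sigma_inv_def using quotientI[OF s] by blast
  qed
qed

end
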